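(* Let $1<g\in\mathbb{N}$ and let $\mathbf{T}=\bigcup_{i\ge1}T_i$ be a $g$-discrete self-similar fractal with generator $G$. Then the full grid graph of $\mathbf{T}$ is a tree if and only if (a) the full grid graph of $G$ is a tree, and (b) $nhb_G=nvb_G=1$.
   Context: For $g\in\mathbb{N}$ write $\mathbb{N}_g=\{0,\dots,g-1\}$; for $A,B\subseteq\mathbb{N}^2$ and $k\in\mathbb{N}$, $A+kB=\{\vec m+k\vec n : \vec m\in A,\vec n\in B\}$. Let $1<g\in\mathbb{N}$. A set $\mathbf{X}\subset\mathbb{N}^2$ is a $g$-discrete self-similar fractal if there is a set $G$ with $\{(0,0)\}\subsetneq G\subsetneq\mathbb{N}_g^2$ having at least one point in every row and every column of $\mathbb{N}_g^2$ such that $\mathbf{X}=\bigcup_{i\ge1}X_i$, where $X_1=G$ and $X_{i+1}=X_i+g^iG$; $G$ is the generator. The full grid graph of $V\subseteq\mathbb{Z}^2$ has vertex set $V$ and an edge between $\vec x,\vec y$ iff $\|\vec x-\vec y\|=1$; "tree" means this graph is connected and acyclic. For a finite $S\subseteq\mathbb{Z}^2$ let $l_S=\min_{(x,y)\in S}x$, $r_S=\max_{(x,y)\in S}x$, $b_S=\min_{(x,y)\in S}y$, $t_S=\max_{(x,y)\in S}y$. An h-bridge of $S$ is a subset of $S$ of the form $\{(l_S,y),(r_S,y)\}$ (both points in $S$); a v-bridge of $S$ is a subset of $S$ of the form $\{(x,b_S),(x,t_S)\}$. $nhb_S$ and $nvb_S$ denote the number of h-bridges and v-bridges of $S$. *)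

theory Defs
  imports Main
begin

type_synonym pt = "nat \<times> nat"

definition grid_adj :: "pt \<Rightarrow> pt \<Rightarrow> bool" where
  "grid_adj p q \<longleftrightarrow>
     (fst p = fst q \<and> (snd p = snd q + 1 \<or> snd q = snd p + 1)) \<or>
     (snd p = snd q \<and> (fst p = fst q + 1 \<or> fst q = fst p + 1))"

definition grid_path_in :: "pt set \<Rightarrow> pt list \<Rightarrow> bool" where
  "grid_path_in V p \<longleftrightarrow> p \<noteq> [] \<and> set p \<subseteq> V \<and>
     (\<forall>i. Suc i < length p \<longrightarrow> grid_adj (p ! i) (p ! Suc i))"

definition grid_connected :: "pt set \<Rightarrow> bool" where
  "grid_connected V \<longleftrightarrow>
     (\<forall>u\<in>V. \<forall>v\<in>V. \<exists>p. grid_path_in V p \<and> hd p = u \<and> last p = v)"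

definition grid_cycle_in :: "pt set \<Rightarrow> pt list \<Rightarrow> bool" where
  "grid_cycle_in V c \<longleftrightarrow> grid_path_in V c \<and> distinct c \<and> length c \<ge> 3 \<and>
     grid_adj (last c) (hd c)"

definition grid_acyclic :: "pt set \<Rightarrow> bool" where
  "grid_acyclic V \<longleftrightarrow> \<not> (\<exists>c. grid_cycle_in V c)"

definition grid_tree :: "pt set \<Rightarrow> bool" where
  "grid_tree V \<longleftrightarrow> grid_connected V \<and> grid_acyclic V"

definition is_generator :: "nat \<Rightarrow> pt set \<Rightarrow> bool" where
  "is_generator g G \<longleftrightarrow>
     {(0,0)} \<subset> G \<and> G \<subset> {0..<g} \<times> {0..<g} \<and>
     (\<forall>y<g. \<exists>x. (x, y) \<in> G) \<and> (\<forall>x<g. \<exists>y. (x, y) \<in> G)"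

definition set_plus_scaled :: "pt set \<Rightarrow> nat \<Rightarrow> pt set \<Rightarrow> pt set" where
  "set_plus_scaled A k B = {(fst m + k * fst n, snd m + k * snd n) | m n. m \<in> A \<and> n \<in> B}"

text \<open>fractal_level g G i = X_(i+1): X_1 = G, X_(i+1) = X_i + g^i G.\<close>
primrec fractal_level :: "nat \<Rightarrow> pt set \<Rightarrow> nat \<Rightarrow> pt set" where
  "fractal_level g G 0 = G"
| "fractal_level g G (Suc i) = set_plus_scaled (fractal_level g G i) (g ^ Suc i) G"

definition fractal :: "nat \<Rightarrow> pt set \<Rightarrow> pt set" where
  "fractal g G = (\<Union>i. fractal_level g G i)"

definition lS :: "pt set \<Rightarrow> nat" where "lS S = Min (fst ` S)"
definition rS :: "pt set \<Rightarrow> nat" where "rS S = Max (fst ` S)"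
definition bS :: "pt set \<Rightarrow> nat" where "bS S = Min (snd ` S)"
definition tS :: "pt set \<Rightarrow> nat" where "tS S = Max (snd ` S)"

definition hbridges :: "pt set \<Rightarrow> pt set set" where
  "hbridges S = {{(lS S, y), (rS S, y)} | y. (lS S, y) \<in> S \<and> (rS S, y) \<in> S}"
definition vbridges :: "pt set \<Rightarrow> pt set set" where
  "vbridges S = {{(x, bS S), (x, tS S)} | x. (x, bS S) \<in> S \<and> (x, tS S) \<in> S}"

definition nhb :: "pt set \<Rightarrow> nat" where "nhb S = card (hbridges S)"
definition nvb :: "pt set \<Rightarrow> nat" where "nvb S = card (vbridges S)"

end

(*
  Write v = |G| and let h, w be the numbers of h- and v-bridges.  The fractal T is G + g T, so each
  point of T stands for a copy ("block") of the finite level T_n, and adjacent blocks are joined by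
  h^n respectively w^n edges.  If G is a tree and h = w = 1, every level is connected with one edge
  fewer than vertices, hence a tree, and T is the increasing union of these trees.

  Conversely let T be a tree.  Rooting T outside a finite set S, the number of points of S whose
  parent lies outside S is |S| minus the number of edges of S.

  Applied to a maximal run of m consecutive blocks, this number is m (v^n - e_n) - (m - 1) h^n, and it
  is at most 2 m w^n since the run can only be left through its long sides.  If w < h, all finite
  maximal runs have the same length m, which is impossible.  Hence h = w = k by symmetry, and applied
  to T_n itself the count forces that G has exactly v - k edges.  For k = 1 the points of G have a
  single exit, so G is connected.

  Suppose k >= 2.  If some edge of T, in direction d, has a finite side, its blocks are drained
  through exactly the k contacts on side d, which turns G into a forest directed towards these
  contacts; all its arrows point along edges with finite side again, so horizontal and vertical
  directions both occur.  If one of the four directions is missing, the flow between two sides cannot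
  turn along that axis, so all contacts of one side flow to the same corner, against k >= 2.  If all
  four occur, each component of G has exactly one contact on each side, so different components of a
  block are never joined in T.  If finally no edge has a finite side, all degrees are at least 2, and
  counting in T_n shows that they all equal 2; but the degree of an end point of an h-bridge depends
  on whether the adjacent block is present.
*)
theory Submission
  imports Defs Complex_Main
begin

section \<open>Directions and edges\<close>

datatype dir = East | West | North | South

fun opp :: "dir \<Rightarrow> dir" where
  "opp East = West" | "opp West = East" | "opp North = South" | "opp South = North"

fun horiz :: "dir \<Rightarrow> bool" where
  "horiz East = True" | "horiz West = True" | "horiz North = False" | "horiz South = False"

definition crd :: "dir \<Rightarrow> pt \<Rightarrow> nat" where
  "crd d a = (if horiz d then fst a else snd a)"

text \<open>A relation and not a function, because points on the axes have no western or southern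
  neighbour among the natural numbers.\<close>

fun nb :: "dir \<Rightarrow> pt \<Rightarrow> pt \<Rightarrow> bool" where
  "nb East a b \<longleftrightarrow> fst b = Suc (fst a) \<and> snd b = snd a"
| "nb West a b \<longleftrightarrow> fst a = Suc (fst b) \<and> snd b = snd a"
| "nb North a b \<longleftrightarrow> fst b = fst a \<and> snd b = Suc (snd a)"
| "nb South a b \<longleftrightarrow> fst b = fst a \<and> snd a = Suc (snd b)"

lemma opp_opp [simp]: "opp (opp d) = d"
  by (cases d) auto

lemma horiz_opp [simp]: "horiz (opp d) = horiz d"
  by (cases d) auto

lemma nb_opp: "nb (opp d) a b = nb d b a"
  by (cases d) auto

lemma nb_unique_dir: "nb d a b \<Longrightarrow> nb d' a b \<Longrightarrow> d = d'"
  by (cases d; cases d') auto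

lemma nb_unique: "nb d a b \<Longrightarrow> nb d a b' \<Longrightarrow> b = b'"
  by (cases d) (auto intro: prod_eqI)

lemma nb_neq: "nb d a b \<Longrightarrow> a \<noteq> b"
  by (cases d) auto

lemma grid_adj_iff_nb: "grid_adj a b \<longleftrightarrow> (\<exists>d. nb d a b)"
proof
  assume "grid_adj a b"
  then have "nb East a b \<or> nb West a b \<or> nb North a b \<or> nb South a b"
    by (auto simp: grid_adj_def)
  then show "\<exists>d. nb d a b" by blast
next
  assume "\<exists>d. nb d a b"
  then obtain d where "nb d a b" by blast
  then show "grid_adj a b" by (cases d) (auto simp: grid_adj_def)
qed

lemma grid_adj_sym: "grid_adj a b \<longleftrightarrow> grid_adj b a"
  by (auto simp: grid_adj_def)

lemma grid_adj_irrefl [simp]: "\<not> grid_adj a a"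
  by (auto simp: grid_adj_def)

lemma finite_grid_adj: "finite {b. grid_adj a b}"
proof -
  have "{b. grid_adj a b} \<subseteq> {..Suc (fst a)} \<times> {..Suc (snd a)}"
    by (auto simp: grid_adj_def)
  then show ?thesis by (rule finite_subset) auto
qed

definition edge_rel :: "pt set \<Rightarrow> (pt \<times> pt) set" where
  "edge_rel S = {(a, b). a \<in> S \<and> b \<in> S \<and> grid_adj a b}"

definition edge_starts :: "dir \<Rightarrow> pt set \<Rightarrow> pt set" where
  "edge_starts d S = {a \<in> S. \<exists>b\<in>S. nb d a b}"

text \<open>Horizontal and vertical edges are recorded by their western and southern ends, so every
  undirected edge counts once.\<close>

definition edges :: "pt set \<Rightarrow> nat" where
  "edges S = card (edge_starts East S) + card (edge_starts North S)"

lemma finite_edge_rel: "finite S \<Longrightarrow> finite (edge_rel S)"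
  by (rule finite_subset[of _ "S \<times> S"]) (auto simp: edge_rel_def)

lemma edge_rel_sym: "(a, b) \<in> edge_rel S \<Longrightarrow> (b, a) \<in> edge_rel S"
  by (auto simp: edge_rel_def grid_adj_sym)

lemma sym_edge_rel: "sym (edge_rel S)"
  by (auto intro: symI edge_rel_sym)

lemma card_dir_pairs:
  "card {(a, b). a \<in> S \<and> b \<in> S \<and> nb d a b} = card (edge_starts d S)"
proof -
  have "bij_betw fst {(a, b). a \<in> S \<and> b \<in> S \<and> nb d a b} (edge_starts d S)"
    unfolding bij_betw_def
  proof
    show "inj_on fst {(a, b). a \<in> S \<and> b \<in> S \<and> nb d a b}"
      by (auto intro!: inj_onI dest: nb_unique)
    show "fst ` {(a, b). a \<in> S \<and> b \<in> S \<and> nb d a b} = edge_starts d S"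
      unfolding edge_starts_def by force
  qed
  then show ?thesis by (rule bij_betw_same_card)
qed

lemma card_dir_pairs_opp:
  "card {(a, b). a \<in> S \<and> b \<in> S \<and> nb (opp d) a b} = card (edge_starts d S)"
proof -
  have "{(a, b). a \<in> S \<and> b \<in> S \<and> nb (opp d) a b} = {(a, b). a \<in> S \<and> b \<in> S \<and> nb d a b}\<inverse>"
    by (auto simp: nb_opp)
  then show ?thesis by (simp only: card_inverse card_dir_pairs)
qed

lemma card_edge_rel:
  assumes "finite S"
  shows "card (edge_rel S) = 2 * edges S"
proof -
  define P where "P d = {(a, b). a \<in> S \<and> b \<in> S \<and> nb d a b}" for d
  have fin: "finite (P d)" for d
    by (rule finite_subset[of _ "S \<times> S"]) (auto simp: P_def assms)
  have disj: "P d \<inter> P d' = {}" if "d \<noteq> d'" for d d'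
    using that by (auto simp: P_def dest: nb_unique_dir)
  have "edge_rel S = (P East \<union> P West) \<union> (P North \<union> P South)"
  proof -
    have "(\<exists>d. nb d a b) \<longleftrightarrow> nb East a b \<or> nb West a b \<or> nb North a b \<or> nb South a b" for a b
      by (metis dir.exhaust)
    then show ?thesis
      by (auto simp: edge_rel_def P_def grid_adj_iff_nb simp del: nb.simps)
  qed
  moreover have "(P East \<union> P West) \<inter> (P North \<union> P South) = {}"
    using disj[of East North] disj[of East South] disj[of West North] disj[of West South] by auto
  ultimately have "card (edge_rel S) = card (P East) + card (P West) + (card (P North) + card (P South))"
    by (simp add: card_Un_disjoint fin disj)
  then show ?thesis
    using card_dir_pairs_opp[of S East] card_dir_pairs_opp[of S North]
    by (simp add: edges_def P_def card_dir_pairs del: nb.simps)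
qed

section \<open>Connectedness, cycles and rooted trees\<close>

lemma grid_path_in_Cons:
  "grid_path_in V (x # ys) \<longleftrightarrow>
     x \<in> V \<and> (ys = [] \<or> grid_adj x (hd ys) \<and> grid_path_in V ys)"
proof (cases ys)
  case Nil
  then show ?thesis by (simp add: grid_path_in_def)
next
  case (Cons y zs)
  have "(\<forall>i. Suc i < length (x # ys) \<longrightarrow> grid_adj ((x # ys) ! i) ((x # ys) ! Suc i)) \<longleftrightarrow>
    grid_adj x (hd ys) \<and> (\<forall>i. Suc i < length ys \<longrightarrow> grid_adj (ys ! i) (ys ! Suc i))"
    (is "?L \<longleftrightarrow> ?R")
  proof
    assume L: ?L
    show ?R using L[rule_format, of 0] L[rule_format, of "Suc _"] Cons by auto
  next
    assume R: ?R
    show ?L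
    proof (intro allI impI)
      fix i assume "Suc i < length (x # ys)"
      then show "grid_adj ((x # ys) ! i) ((x # ys) ! Suc i)"
        using R Cons by (cases i) auto
    qed
  qed
  then show ?thesis using Cons by (auto simp: grid_path_in_def)
qed

lemma path_imp_rtrancl:
  "grid_path_in V p \<Longrightarrow> (hd p, last p) \<in> (edge_rel V)\<^sup>*"
proof (induction p)
  case Nil
  then show ?case by (simp add: grid_path_in_def)
next
  case (Cons x ys)
  show ?case
  proof (cases "ys = []")
    case False
    then have "grid_path_in V ys" "(x, hd ys) \<in> edge_rel V"
      using Cons.prems by (auto simp: grid_path_in_Cons edge_rel_def) (auto simp: grid_path_in_def)
    then show ?thesis using Cons.IH False by (auto intro: converse_rtrancl_into_rtrancl)
  qed simp
qed

lemma rtrancl_imp_path: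
  assumes "(u, v) \<in> (edge_rel V)\<^sup>*" "v \<in> V"
  shows "\<exists>p. grid_path_in V p \<and> hd p = u \<and> last p = v"
  using assms
proof (induction rule: converse_rtrancl_induct)
  case base
  then show ?case by (intro exI[of _ "[v]"]) (simp add: grid_path_in_Cons)
next
  case (step y z)
  then obtain p where p: "grid_path_in V p" "hd p = z" "last p = v" by blast
  then have "p \<noteq> []" by (auto simp: grid_path_in_def)
  then show ?case using p step.hyps
    by (intro exI[of _ "y # p"]) (auto simp: grid_path_in_Cons edge_rel_def)
qed

lemma grid_connected_iff:
  "grid_connected V \<longleftrightarrow> (\<forall>u\<in>V. \<forall>v\<in>V. (u, v) \<in> (edge_rel V)\<^sup>*)"
  unfolding grid_connected_def by (metis path_imp_rtrancl rtrancl_imp_path)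

lemma edge_rel_mono: "S \<subseteq> V \<Longrightarrow> edge_rel S \<subseteq> edge_rel V"
  by (auto simp: edge_rel_def)

lemma grid_acyclic_mono: "grid_acyclic V \<Longrightarrow> S \<subseteq> V \<Longrightarrow> grid_acyclic S"
  unfolding grid_acyclic_def grid_cycle_in_def grid_path_in_def by (meson subset_trans)

section \<open>Leaves and edge counts of finite acyclic sets\<close>

text \<open>Longest-path argument: every neighbour of the first point of a longest simple path lies
  on that path, and a neighbour other than the second point closes a cycle.\<close>

lemma acyclic_has_leaf:
  assumes "finite S" "S \<noteq> {}" "grid_acyclic S"
  shows "\<exists>u\<in>S. \<forall>b\<in>S. \<forall>b'\<in>S. grid_adj u b \<longrightarrow> grid_adj u b' \<longrightarrow> b = b'"
proof (rule ccontr)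
  assume neg: "\<not> ?thesis"
  define P where "P p \<longleftrightarrow> grid_path_in S p \<and> distinct p" for p
  obtain s where s: "s \<in> S" using assms(2) by blast
  have P1: "P [s]" using s by (simp add: P_def grid_path_in_Cons)
  have bnd: "\<forall>p. P p \<longrightarrow> length p < Suc (card S)"
    unfolding P_def grid_path_in_def
    by (metis assms(1) card_mono distinct_card less_Suc_eq_le)
  obtain p where p: "P p" and pmax: "\<And>q. P q \<Longrightarrow> length q \<le> length p"
    using ex_has_greatest_nat[of P "[s]" length "Suc (card S)"] P1 bnd by blast
  obtain x ys where xys: "p = x # ys" using p by (cases p) (auto simp: P_def grid_path_in_def)
  have xS: "x \<in> S" using p xys by (simp add: P_def grid_path_in_Cons)
  then obtain b b' where bb: "b \<in> S" "b' \<in> S" "grid_adj x b" "grid_adj x b'" "b \<noteq> b'"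
    using neg by blast
  have inp: "z \<in> set p" if "z \<in> S" "grid_adj x z" for z
  proof (rule ccontr)
    assume "z \<notin> set p"
    then have "P (z # p)"
      using p that xys by (simp add: P_def grid_path_in_Cons grid_adj_sym)
    then show False using pmax by fastforce
  qed
  obtain z where z: "z \<in> S" "grid_adj x z" "ys = [] \<or> z \<noteq> hd ys" using bb by metis
  have "z \<noteq> x" using z(2) by auto
  then obtain j where j: "j < length ys" "ys ! j = z"
    using inp[OF z(1,2)] xys by (auto simp: in_set_conv_nth)
  have "j \<noteq> 0"
  proof
    assume "j = 0"
    then have "ys \<noteq> []" "z = hd ys" using j by (auto simp: hd_conv_nth)
    then show False using z(3) by simp
  qed
  \<comment> \<open>The initial segment of \<open>p\<close> ending in \<open>z\<close>; since
    \<open>z\<close> is not the second point, it has at least three points.\<close>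
  define c where "c = take (Suc (Suc j)) p"
  have c_last: "last c = z"
  proof -
    have "ys \<noteq> []" using j(1) by auto
    then show ?thesis using j xys by (simp add: c_def last_conv_nth)
  qed
  have "grid_cycle_in S c"
    unfolding grid_cycle_in_def
  proof (intro conjI)
    show "grid_path_in S c"
      using p unfolding P_def grid_path_in_def c_def by (auto dest: in_set_takeD)
    show "distinct c" using p by (simp add: P_def c_def)
    show "3 \<le> length c" using j \<open>j \<noteq> 0\<close> by (simp add: c_def xys)
    show "grid_adj (last c) (hd c)"
      unfolding c_last using z(2) by (simp add: c_def xys grid_adj_sym)
  qed
  then show False using assms(3) by (auto simp: grid_acyclic_def)
qed

text \<open>Induction by removing a leaf, which takes away at most two ordered pairs.\<close>

lemma acyclic_card_edge_rel:
  assumes "finite S" "S \<noteq> {}" "grid_acyclic S"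
  shows "card (edge_rel S) \<le> 2 * (card S - 1)"
  using assms
proof (induction "card S" arbitrary: S)
  case 0
  then show ?case by simp
next
  case (Suc n)
  obtain u where u: "u \<in> S" "\<And>b b'. b \<in> S \<Longrightarrow> b' \<in> S \<Longrightarrow> grid_adj u b \<Longrightarrow> grid_adj u b' \<Longrightarrow> b = b'"
    using acyclic_has_leaf[OF Suc.prems] by blast
  show ?case
  proof (cases "S = {u}")
    case True
    then have "edge_rel S = {}" by (auto simp: edge_rel_def)
    then show ?thesis by simp
  next
    case False
    define S' where "S' = S - {u}"
    have S': "S' \<noteq> {}" "finite S'" "grid_acyclic S'" "card S' = n"
      using False u(1) Suc.prems Suc.hyps(2) grid_acyclic_mono[of S S'] by (auto simp: S'_def)
    have IH: "card (edge_rel S') \<le> 2 * (card S' - 1)"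
      using Suc.hyps(1)[OF _ S'(2,1,3)] S'(4) by simp
    \<comment> \<open>\<open>w\<close> is the only neighbour of the leaf \<open>u\<close>; if
      \<open>u\<close> is isolated, any point serves.\<close>
    obtain w where w: "edge_rel S \<subseteq> edge_rel S' \<union> {(u, w), (w, u)}"
    proof (cases "\<exists>w\<in>S. grid_adj u w")
      case True
      then obtain w where "w \<in> S" "grid_adj u w" by blast
      have only_w: "b = w" if "b \<in> S" "grid_adj u b \<or> grid_adj b u" for b
      proof -
        have "grid_adj u b" using that(2) grid_adj_sym[of u b] by simp
        then show ?thesis using u(2)[OF that(1) \<open>w \<in> S\<close>] \<open>grid_adj u w\<close> by simp
      qed
      have "edge_rel S \<subseteq> edge_rel S' \<union> {(u, w), (w, u)}"
      proof (rule subrelI)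
        fix a b assume "(a, b) \<in> edge_rel S"
        then show "(a, b) \<in> edge_rel S' \<union> {(u, w), (w, u)}"
          using only_w[of a] only_w[of b] by (cases "a = u"; cases "b = u") (auto simp: edge_rel_def S'_def)
      qed
      then show ?thesis using that by blast
    next
      case False
      then have "a \<noteq> u \<and> b \<noteq> u" if "a \<in> S" "b \<in> S" "grid_adj a b" for a b
        using that grid_adj_sym[of a b] by blast
      then have "edge_rel S \<subseteq> edge_rel S'"
        unfolding edge_rel_def S'_def by auto
      then show ?thesis using that by blast
    qed
    have "card (edge_rel S) \<le> card (edge_rel S' \<union> {(u, w), (w, u)})"
      using card_mono[OF _ w] finite_edge_rel[OF S'(2)] by simp
    also have "\<dots> \<le> card (edge_rel S') + card {(u, w), (w, u)}" by (rule card_Un_le)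
    also have "\<dots> \<le> 2 * (card S' - 1) + 2"
      by (rule add_mono[OF IH]) (cases "u = w"; simp)
    also have "\<dots> = 2 * (card S - 1)"
    proof -
      have "card S' \<ge> 1" using S'(1,2) by (simp add: Suc_le_eq card_gt_0_iff)
      then show ?thesis using S'(4) Suc.hyps(2) by simp
    qed
    finally show ?thesis .
  qed
qed

section \<open>Parent maps and rooted trees\<close>

text \<open>\<open>\<delta>\<close> is the depth, which allows induction even if \<open>V\<close> is
  infinite. The value \<open>p r\<close> stays arbitrary, so later statements single out
  \<open>r\<close>.\<close>

definition parent_map :: "pt set \<Rightarrow> pt \<Rightarrow> (pt \<Rightarrow> pt) \<Rightarrow> (pt \<Rightarrow> nat) \<Rightarrow> bool" where
  "parent_map V r p \<delta> \<longleftrightarrow> r \<in> V \<and> \<delta> r = 0 \<and>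
     (\<forall>u\<in>V - {r}. p u \<in> V \<and> grid_adj u (p u) \<and> \<delta> u = Suc (\<delta> (p u)))"

definition rooted_tree :: "pt set \<Rightarrow> pt \<Rightarrow> (pt \<Rightarrow> pt) \<Rightarrow> (pt \<Rightarrow> nat) \<Rightarrow> bool" where
  "rooted_tree V r p \<delta> \<longleftrightarrow> parent_map V r p \<delta> \<and>
     (\<forall>a\<in>V. \<forall>b\<in>V. grid_adj a b \<longrightarrow> a \<noteq> r \<and> b = p a \<or> b \<noteq> r \<and> a = p b)"

lemma parent_mapD:
  assumes "parent_map V r p \<delta>" "u \<in> V" "u \<noteq> r"
  shows "p u \<in> V" "grid_adj u (p u)" "\<delta> u = Suc (\<delta> (p u))"
  using assms unfolding parent_map_def by blast+

lemma parent_map_no_2cycle: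
  assumes pm: "parent_map V r p \<delta>" and u: "u \<in> V" "u \<noteq> r" "p u \<noteq> r"
  shows "p (p u) \<noteq> u"
proof
  assume eq: "p (p u) = u"
  have "\<delta> u = Suc (\<delta> (p u))" using parent_mapD(3)[OF pm u(1,2)] .
  moreover have "\<delta> (p u) = Suc (\<delta> u)"
    using parent_mapD(3)[OF pm parent_mapD(1)[OF pm u(1,2)] u(3)] unfolding eq .
  ultimately show False by simp
qed

text \<open>Breadth-first search: the depth is the graph distance from \<open>r\<close>, and the
  parent is a predecessor on a shortest path.\<close>

lemma parent_map_exists:
  assumes conn: "grid_connected V" and r: "r \<in> V"
  shows "\<exists>p \<delta>. parent_map V r p \<delta>"
proof -
  let ?R = "edge_rel V"
  define \<delta> where "\<delta> u = (LEAST n. (r, u) \<in> ?R ^^ n)" for u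
  have mem: "(r, u) \<in> ?R ^^ \<delta> u" if "u \<in> V" for u
  proof -
    have "(r, u) \<in> ?R\<^sup>*" using conn r that by (auto simp: grid_connected_iff)
    then obtain n where "(r, u) \<in> ?R ^^ n" by (auto dest: rtrancl_imp_relpow)
    then show ?thesis unfolding \<delta>_def by (rule LeastI)
  qed
  have least: "\<delta> u \<le> n" if "(r, u) \<in> ?R ^^ n" for u n
    unfolding \<delta>_def using that by (rule Least_le)
  have d0: "\<delta> r = 0" using least[of r 0] by simp
  have "\<exists>w. w \<in> V \<and> grid_adj u w \<and> \<delta> u = Suc (\<delta> w)" if u: "u \<in> V - {r}" for u
  proof -
    have "\<delta> u \<noteq> 0"
    proof
      assume "\<delta> u = 0"
      then show False using mem[of u] u by simp
    qed
    then obtain n where n: "\<delta> u = Suc n" using not0_implies_Suc by blast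
    then obtain w where w: "(r, w) \<in> ?R ^^ n" "(w, u) \<in> ?R"
      using mem[of u] u by (metis DiffD1 relpow_Suc_E)
    have wV: "w \<in> V" "grid_adj u w"
      using w(2) grid_adj_sym unfolding edge_rel_def by blast+
    have "(r, u) \<in> ?R ^^ Suc (\<delta> w)" using mem[OF wV(1)] w(2) by (rule relpow_Suc_I)
    then have "\<delta> u \<le> Suc (\<delta> w)" by (rule least)
    moreover have "\<delta> w \<le> n" using w(1) by (rule least)
    ultimately have "\<delta> u = Suc (\<delta> w)" using n by linarith
    then show ?thesis using wV by blast
  qed
  then have "\<exists>p. \<forall>u\<in>V - {r}. p u \<in> V \<and> grid_adj u (p u) \<and> \<delta> u = Suc (\<delta> (p u))"
    by (intro bchoice) blast
  then show ?thesis using r d0 unfolding parent_map_def by blast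
qed

text \<open>Each point of \<open>K\<close> other than the root contributes its parent edge in both
  orientations. No pair occurs twice, because two points are never parents of each other.\<close>

lemma parent_map_pairs:
  assumes pm: "parent_map V r p \<delta>" and K: "finite K" "K \<subseteq> V" "r \<in> K"
    and closed: "\<And>u. u \<in> K \<Longrightarrow> u \<noteq> r \<Longrightarrow> p u \<in> K"
  defines "P \<equiv> (\<lambda>u. (u, p u)) ` (K - {r})"
  shows "P \<union> P\<inverse> \<subseteq> edge_rel K" "card (P \<union> P\<inverse>) = 2 * (card K - 1)"
proof -
  have "(u, p u) \<in> edge_rel K" if "u \<in> K - {r}" for u
    using pm K closed[of u] that by (auto simp: edge_rel_def parent_map_def)
  then have P1: "P \<subseteq> edge_rel K"
    unfolding P_def by blast
  have "P\<inverse> \<subseteq> edge_rel K"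
    by (rule subrelI, rule edge_rel_sym) (use P1 in blast)
  with P1 show "P \<union> P\<inverse> \<subseteq> edge_rel K" by simp
  have "P \<inter> P\<inverse> = {}"
  proof (rule equals0I)
    fix x assume "x \<in> P \<inter> P\<inverse>"
    then have "x \<in> P" "prod.swap x \<in> P" by auto
    then obtain a b where a: "a \<in> K - {r}" "x = (a, p a)" and b: "b \<in> K - {r}" "prod.swap x = (b, p b)"
      unfolding P_def by blast
    have "fst (prod.swap x) = p a" "snd (prod.swap x) = a" unfolding a(2) by simp_all
    then have "b = p a" "p b = a" unfolding b(2) fst_conv snd_conv .
    then have "p a \<in> K - {r}" "p (p a) = a" using b(1) by metis+
    then show False using parent_map_no_2cycle[OF pm, of a] a(1) K(2) by blast
  qed
  moreover have "finite P" using K by (simp add: P_def)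
  ultimately have "card (P \<union> P\<inverse>) = card P + card (P\<inverse>)"
    by (simp add: card_Un_disjoint)
  also have "\<dots> = 2 * card P" by (simp add: card_inverse)
  also have "card P = card (K - {r})" unfolding P_def by (rule card_image) (auto intro: inj_onI)
  finally show "card (P \<union> P\<inverse>) = 2 * (card K - 1)" using K by simp
qed

text \<open>The depth drops by one at each step, so a point has finitely many ancestors. This
  reduces questions about an infinite \<open>V\<close> to finite subsets.\<close>

lemma parent_map_ancestors:
  assumes pm: "parent_map V r p \<delta>" and a: "a \<in> V"
  shows "\<exists>K. finite K \<and> K \<subseteq> V \<and> r \<in> K \<and> a \<in> K \<and> (\<forall>u\<in>K. u \<noteq> r \<longrightarrow> p u \<in> K)"
  using a
proof (induction "\<delta> a" arbitrary: a)
  case 0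
  have "a = r"
  proof (rule ccontr)
    assume "a \<noteq> r"
    then show False using parent_mapD(3)[OF pm 0(2)] 0(1) by simp
  qed
  then show ?case using 0(2) by (intro exI[of _ "{r}"]) simp
next
  case (Suc n)
  have "a \<noteq> r" using pm Suc(2) by (auto simp: parent_map_def)
  then have pa: "p a \<in> V" "n = \<delta> (p a)" using parent_mapD[OF pm Suc.prems] Suc(2) by simp_all
  obtain K where K: "finite K" "K \<subseteq> V" "r \<in> K" "p a \<in> K"
      and cl: "\<And>u. u \<in> K \<Longrightarrow> u \<noteq> r \<Longrightarrow> p u \<in> K"
    using Suc.hyps(1)[OF pa(2,1)] by blast
  have "p u \<in> insert a K" if "u \<in> insert a K" "u \<noteq> r" for u
  proof (cases "u = a")
    case True
    then show ?thesis using K(4) by simp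
  next
    case False
    then show ?thesis using cl[of u] that by simp
  qed
  then show ?case using K(1-3) Suc.prems by (intro exI[of _ "insert a K"] conjI) simp_all
qed

text \<open>An edge that is not a parent edge, together with all ancestors of its two ends, would
  give a finite acyclic set with too many edges.\<close>

lemma tree_imp_rooted_tree:
  assumes "grid_tree V" "r \<in> V"
  shows "\<exists>p \<delta>. rooted_tree V r p \<delta>"
proof -
  obtain p \<delta> where pm: "parent_map V r p \<delta>"
    using parent_map_exists assms by (metis grid_tree_def)
  have "a \<noteq> r \<and> b = p a \<or> b \<noteq> r \<and> a = p b" if ab: "a \<in> V" "b \<in> V" "grid_adj a b" for a b
  proof (rule ccontr)
    assume neg: "\<not> ?thesis"
    obtain A where A: "finite A" "A \<subseteq> V" "r \<in> A" "a \<in> A" "\<forall>u\<in>A. u \<noteq> r \<longrightarrow> p u \<in> A"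
      using parent_map_ancestors[OF pm ab(1)] by blast
    obtain B where B: "finite B" "B \<subseteq> V" "r \<in> B" "b \<in> B" "\<forall>u\<in>B. u \<noteq> r \<longrightarrow> p u \<in> B"
      using parent_map_ancestors[OF pm ab(2)] by blast
    define K where "K = A \<union> B"
    define P where "P = (\<lambda>u. (u, p u)) ` (K - {r})"
    have K: "finite K" "K \<subseteq> V" "r \<in> K"
      using A(1-3) B(1,2) by (auto simp: K_def)
    have cl: "p u \<in> K" if "u \<in> K" "u \<noteq> r" for u
      using A(5) B(5) that unfolding K_def by blast
    have P: "P \<union> P\<inverse> \<subseteq> edge_rel K" "card (P \<union> P\<inverse>) = 2 * (card K - 1)"
      unfolding P_def using parent_map_pairs[OF pm K] cl by blast+
    have "(a, b) \<in> edge_rel K" using ab A(4) B(4) by (auto simp: edge_rel_def K_def)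
    moreover have "(a, b) \<notin> P \<union> P\<inverse>" using neg by (auto simp: P_def)
    ultimately have "P \<union> P\<inverse> \<subset> edge_rel K" using P(1) by blast
    then have "2 * (card K - 1) < card (edge_rel K)"
      using P(2) psubset_card_mono[OF finite_edge_rel[OF K(1)]] by metis
    moreover have "card (edge_rel K) \<le> 2 * (card K - 1)"
      using K assms(1) by (intro acyclic_card_edge_rel) (auto simp: grid_tree_def elim: grid_acyclic_mono)
    ultimately show False by simp
  qed
  then show ?thesis using pm unfolding rooted_tree_def by blast
qed

text \<open>A deepest point of a cycle would have its parent as both of its neighbours on the
  cycle.\<close>

lemma rooted_tree_acyclic:
  assumes rt: "rooted_tree V r p \<delta>"
  shows "grid_acyclic V"
  unfolding grid_acyclic_def
proof
  assume "\<exists>c. grid_cycle_in V c"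
  then obtain c where c: "grid_path_in V c" "distinct c" "length c \<ge> 3" "grid_adj (last c) (hd c)"
    by (auto simp: grid_cycle_in_def)
  define n where "n = length c"
  have n3: "n \<ge> 3" using c by (simp add: n_def)
  define nx where "nx i = (if Suc i < n then Suc i else 0)" for i
  have nx: "nx i < n" if "i < n" for i using that n3 by (auto simp: nx_def)
  have adj: "grid_adj (c ! i) (c ! nx i)" if "i < n" for i
  proof (cases "Suc i < n")
    case True
    then show ?thesis using c(1) by (auto simp: grid_path_in_def nx_def n_def)
  next
    case False
    then have "i = n - 1" using that by simp
    moreover have "c \<noteq> []" using c(3) by auto
    ultimately show ?thesis using c(4) False
      by (simp add: nx_def n_def last_conv_nth hd_conv_nth)
  qed
  have inV: "c ! i \<in> V" if "i < n" for i using c(1) that by (auto simp: grid_path_in_def n_def)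
  obtain i where i: "i < n" "\<And>j. j < n \<Longrightarrow> \<delta> (c ! j) \<le> \<delta> (c ! i)"
  proof -
    have "\<exists>i. i < n \<and> (\<forall>j. j < n \<longrightarrow> \<delta> (c ! j) \<le> \<delta> (c ! i))"
      using ex_has_greatest_nat[of "\<lambda>i. i < n" 0 "\<lambda>i. \<delta> (c ! i)" "Suc (Max ((\<lambda>i. \<delta> (c ! i)) ` {..<n}))"] n3
      by (auto simp: less_Suc_eq_le)
    then show ?thesis using that by blast
  qed
  have key: "b = p (c ! i)" if "b \<in> V" "grid_adj (c ! i) b" "\<delta> b \<le> \<delta> (c ! i)" for b
    using rt inV[OF i(1)] that by (fastforce simp: rooted_tree_def parent_map_def)
  define j where "j = (if i = 0 then n - 1 else i - 1)"
  have j: "j < n" "nx j = i" "j \<noteq> nx i" using i(1) n3 by (auto simp: j_def nx_def)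
  have "c ! nx i = p (c ! i)" using key adj nx i inV by blast
  moreover have "c ! j = p (c ! i)"
    using key[of "c ! j"] adj[OF j(1)] j i inV grid_adj_sym by metis
  ultimately show False
    using c(2) j nx[OF i(1)] by (metis n_def nth_eq_iff_index_eq)
qed

text \<open>The parent edges alone already number \<open>card V - 1\<close>, so the count leaves no
  room for another edge.\<close>

lemma connected_card_imp_tree:
  assumes "finite V" "V \<noteq> {}" "grid_connected V" "Suc (edges V) = card V"
  shows "grid_tree V"
proof -
  obtain r where r: "r \<in> V" using assms(2) by blast
  obtain p \<delta> where pm: "parent_map V r p \<delta>" using parent_map_exists[OF assms(3) r] by blast
  define P where "P = (\<lambda>u. (u, p u)) ` (V - {r})"
  have P: "P \<union> P\<inverse> \<subseteq> edge_rel V" "card (P \<union> P\<inverse>) = 2 * (card V - 1)"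
    unfolding P_def using parent_map_pairs[OF pm assms(1) subset_refl r] pm
    by (simp_all add: parent_map_def)
  have "card (edge_rel V) = card (P \<union> P\<inverse>)"
    using P(2) card_edge_rel[OF assms(1)] assms(4) by simp
  then have "P \<union> P\<inverse> = edge_rel V"
    using P(1) finite_edge_rel[OF assms(1)] by (metis card_subset_eq)
  then have "rooted_tree V r p \<delta>"
    using pm unfolding rooted_tree_def by (auto simp: P_def edge_rel_def)
  then show ?thesis using rooted_tree_acyclic assms(3) by (auto simp: grid_tree_def)
qed

text \<open>The edges inside \<open>S\<close> correspond to the points of \<open>S\<close> whose
  parent lies in \<open>S\<close>; the other points are the exits. This is the main counting tool
  below.\<close>

lemma rooted_tree_exits:
  assumes rt: "rooted_tree V r p \<delta>" and S: "finite S" "S \<subseteq> V" "r \<notin> S"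
  shows "card {u \<in> S. p u \<notin> S} + edges S = card S"
proof -
  define P where "P = (\<lambda>u. (u, p u)) ` {u \<in> S. p u \<in> S}"
  have pm: "parent_map V r p \<delta>" using rt by (simp add: rooted_tree_def)
  have "edge_rel S = P \<union> P\<inverse>"
  proof
    show "edge_rel S \<subseteq> P \<union> P\<inverse>"
    proof
      fix x assume "x \<in> edge_rel S"
      then obtain a b where x: "x = (a, b)" "a \<in> S" "b \<in> S" "grid_adj a b"
        by (auto simp: edge_rel_def)
      then have "b = p a \<or> a = p b" using rt S by (auto simp: rooted_tree_def)
      then show "x \<in> P \<union> P\<inverse>" using x by (auto simp: P_def)
    qed
    have "(u, p u) \<in> edge_rel S" if "u \<in> S" "p u \<in> S" for u
      using pm S that by (auto simp: edge_rel_def parent_map_def)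
    then have P1: "P \<subseteq> edge_rel S"
      unfolding P_def by blast
    have "P\<inverse> \<subseteq> edge_rel S"
      by (rule subrelI, rule edge_rel_sym) (use P1 in blast)
    with P1 show "P \<union> P\<inverse> \<subseteq> edge_rel S" by simp
  qed
  moreover have "P \<inter> P\<inverse> = {}"
  proof (rule equals0I)
    fix x assume "x \<in> P \<inter> P\<inverse>"
    then have "x \<in> P" "prod.swap x \<in> P" by auto
    then obtain a b where a: "a \<in> S" "x = (a, p a)" and b: "b \<in> S" "prod.swap x = (b, p b)"
      unfolding P_def by blast
    have "fst (prod.swap x) = p a" "snd (prod.swap x) = a" unfolding a(2) by simp_all
    then have "b = p a" "p b = a" unfolding b(2) fst_conv snd_conv .
    then have "p a \<in> S" "p (p a) = a" using b(1) by metis+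
    then show False using parent_map_no_2cycle[OF pm, of a] a(1) S(2,3) by blast
  qed
  moreover have "finite P" using S by (simp add: P_def)
  ultimately have "2 * edges S = card P + card P"
    using card_edge_rel[OF S(1)] by (simp add: card_Un_disjoint card_inverse)
  moreover have "card P = card {u \<in> S. p u \<in> S}"
    unfolding P_def by (rule card_image) (auto intro: inj_onI)
  moreover have "card S = card {u \<in> S. p u \<in> S} + card {u \<in> S. p u \<notin> S}"
    using S(1) by (subst card_Un_disjoint[symmetric]) (auto intro: arg_cong[where f = card])
  ultimately show ?thesis by simp
qed

section \<open>Block substitution\<close>

text \<open>\<open>pdiv s a\<close> is the position of the block of side \<open>s\<close> containing
  \<open>a\<close>, and \<open>pmod s a\<close> is the place of \<open>a\<close> inside it;
  \<open>plift\<close> recombines the two.\<close>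

definition pdiv :: "nat \<Rightarrow> pt \<Rightarrow> pt" where
  "pdiv s a = (fst a div s, snd a div s)"

definition pmod :: "nat \<Rightarrow> pt \<Rightarrow> pt" where
  "pmod s a = (fst a mod s, snd a mod s)"

definition plift :: "nat \<Rightarrow> pt \<Rightarrow> pt \<Rightarrow> pt" where
  "plift s q c = (s * fst q + fst c, s * snd q + snd c)"

definition in_box :: "nat \<Rightarrow> pt set \<Rightarrow> bool" where
  "in_box s B \<longleftrightarrow> (\<forall>c\<in>B. fst c < s \<and> snd c < s)"

text \<open>Every point of \<open>Q\<close> is replaced by a copy of \<open>B\<close>: if
  \<open>in_box s B\<close> holds, this is the set \<open>B + s Q\<close>, expressed by quotients
  and remainders.\<close>

definition blow :: "nat \<Rightarrow> pt set \<Rightarrow> pt set \<Rightarrow> pt set" where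
  "blow s B Q = {a. pdiv s a \<in> Q \<and> pmod s a \<in> B}"

text \<open>\<open>c\<close> and \<open>c'\<close> are places that face each other across the border
  between a block and its neighbour on side \<open>d\<close>.\<close>

fun wrap :: "dir \<Rightarrow> nat \<Rightarrow> pt \<Rightarrow> pt \<Rightarrow> bool" where
  "wrap East s c c' \<longleftrightarrow> fst c = s - 1 \<and> fst c' = 0 \<and> snd c' = snd c"
| "wrap West s c c' \<longleftrightarrow> fst c' = s - 1 \<and> fst c = 0 \<and> snd c' = snd c"
| "wrap North s c c' \<longleftrightarrow> snd c = s - 1 \<and> snd c' = 0 \<and> fst c' = fst c"
| "wrap South s c c' \<longleftrightarrow> snd c' = s - 1 \<and> snd c = 0 \<and> fst c' = fst c"

text \<open>Contacts on the sides \<open>East\<close> and \<open>West\<close> are the two ends of the h-bridges, those on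
  \<open>North\<close> and \<open>South\<close> the two ends of the v-bridges.\<close>

definition contacts :: "dir \<Rightarrow> nat \<Rightarrow> pt set \<Rightarrow> pt set" where
  "contacts d s B = {c \<in> B. \<exists>c'\<in>B. wrap d s c c'}"

lemma wrap_opp: "wrap (opp d) s c c' = wrap d s c' c"
  by (cases d) auto

lemma wrap_unique: "wrap d s c c' \<Longrightarrow> wrap d s c c'' \<Longrightarrow> c' = c''"
  by (cases d) (auto intro: prod_eqI)

lemma pdiv_plift: "c \<in> B \<Longrightarrow> in_box s B \<Longrightarrow> pdiv s (plift s q c) = q"
  by (cases c; cases q) (auto simp: pdiv_def plift_def in_box_def)

lemma pmod_plift: "c \<in> B \<Longrightarrow> in_box s B \<Longrightarrow> pmod s (plift s q c) = c"
  by (auto simp: pmod_def plift_def in_box_def)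

lemma plift_pdiv_pmod [simp]: "plift s (pdiv s a) (pmod s a) = a"
  by (simp add: pdiv_def pmod_def plift_def)

lemma Suc_div_mod_iff:
  fixes x y s :: nat
  assumes "s > 0"
  shows "y = Suc x \<longleftrightarrow> (x div s = y div s \<and> y mod s = Suc (x mod s)) \<or>
    (y div s = Suc (x div s) \<and> x mod s = s - 1 \<and> y mod s = 0)"
proof
  assume "y = Suc x"
  then show "(x div s = y div s \<and> y mod s = Suc (x mod s)) \<or>
    (y div s = Suc (x div s) \<and> x mod s = s - 1 \<and> y mod s = 0)"
    using assms by (auto simp: div_Suc mod_Suc)
next
  assume "(x div s = y div s \<and> y mod s = Suc (x mod s)) \<or>
    (y div s = Suc (x div s) \<and> x mod s = s - 1 \<and> y mod s = 0)"
  then show "y = Suc x"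
  proof
    assume "x div s = y div s \<and> y mod s = Suc (x mod s)"
    then show ?thesis by (metis add_Suc_right div_mult_mod_eq)
  next
    assume *: "y div s = Suc (x div s) \<and> x mod s = s - 1 \<and> y mod s = 0"
    have "y = (y div s) * s + y mod s" "x = (x div s) * s + x mod s" by simp_all
    with * have "y = Suc (x div s) * s" "x = (x div s) * s + (s - 1)" by simp_all
    then show ?thesis using assms by simp
  qed
qed

lemma eq_div_mod_iff: "(y::nat) = x \<longleftrightarrow> y div s = x div s \<and> y mod s = x mod s"
  by (metis div_mult_mod_eq)

text \<open>In each coordinate, a successor either keeps the quotient or passes from remainder
  \<open>s - 1\<close> to \<open>0\<close>. So an edge is internal to a block or joins facing places
  of adjacent blocks.\<close>

lemma nb_pdiv_pmod:
  assumes "s > 0"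
  shows "nb d a b \<longleftrightarrow> (pdiv s a = pdiv s b \<and> nb d (pmod s a) (pmod s b)) \<or>
    (nb d (pdiv s a) (pdiv s b) \<and> wrap d s (pmod s a) (pmod s b))"
proof (cases d)
  case East
  show ?thesis
    unfolding East nb.simps wrap.simps Suc_div_mod_iff[OF assms, of "fst b" "fst a"]
      eq_div_mod_iff[of "snd b" "snd a" s]
    by (auto simp: pdiv_def pmod_def)
next
  case West
  show ?thesis
    unfolding West nb.simps wrap.simps Suc_div_mod_iff[OF assms, of "fst a" "fst b"]
      eq_div_mod_iff[of "snd b" "snd a" s]
    by (auto simp: pdiv_def pmod_def)
next
  case North
  show ?thesis
    unfolding North nb.simps wrap.simps Suc_div_mod_iff[OF assms, of "snd b" "snd a"]
      eq_div_mod_iff[of "fst b" "fst a" s]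
    by (auto simp: pdiv_def pmod_def)
next
  case South
  show ?thesis
    unfolding South nb.simps wrap.simps Suc_div_mod_iff[OF assms, of "snd a" "snd b"]
      eq_div_mod_iff[of "fst b" "fst a" s]
    by (auto simp: pdiv_def pmod_def)
qed

lemma nb_imp_wrap: "nb d a b \<Longrightarrow> s > 0 \<Longrightarrow> pdiv s a \<noteq> pdiv s b \<Longrightarrow>
    nb d (pdiv s a) (pdiv s b) \<and> wrap d s (pmod s a) (pmod s b)"
  using nb_pdiv_pmod by blast

lemma mem_blow_plift: "in_box s B \<Longrightarrow> c \<in> B \<Longrightarrow> plift s q c \<in> blow s B Q \<longleftrightarrow> q \<in> Q"
  by (simp add: blow_def pdiv_plift pmod_plift)

lemma blow_eq_image: "in_box s B \<Longrightarrow> blow s B Q = (\<lambda>(q, c). plift s q c) ` (Q \<times> B)"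
proof -
  assume box: "in_box s B"
  show ?thesis
  proof
    show "blow s B Q \<subseteq> (\<lambda>(q, c). plift s q c) ` (Q \<times> B)"
    proof
      fix a assume "a \<in> blow s B Q"
      then show "a \<in> (\<lambda>(q, c). plift s q c) ` (Q \<times> B)"
        by (intro image_eqI[of _ _ "(pdiv s a, pmod s a)"]) (simp_all add: blow_def)
    qed
    show "(\<lambda>(q, c). plift s q c) ` (Q \<times> B) \<subseteq> blow s B Q"
      using mem_blow_plift[OF box] by auto
  qed
qed

lemma inj_on_plift: "in_box s B \<Longrightarrow> inj_on (\<lambda>(q, c). plift s q c) (Q \<times> B)"
  by (rule inj_on_inverseI[of _ "\<lambda>a. (pdiv s a, pmod s a)"]) (auto simp: pdiv_plift pmod_plift)

lemma card_blow: "in_box s B \<Longrightarrow> card (blow s B Q) = card Q * card B"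
  by (simp add: blow_eq_image card_image inj_on_plift card_cartesian_product)

lemma finite_blow: "in_box s B \<Longrightarrow> finite B \<Longrightarrow> finite Q \<Longrightarrow> finite (blow s B Q)"
  by (simp add: blow_eq_image)

lemma in_box_mono: "in_box s B \<Longrightarrow> C \<subseteq> B \<Longrightarrow> in_box s C"
  by (auto simp: in_box_def)

lemma contacts_subset: "contacts d s B \<subseteq> B"
  by (auto simp: contacts_def)

lemma edge_starts_subset: "edge_starts d B \<subseteq> B"
  by (auto simp: edge_starts_def)

lemma contacts_edge_starts_disjoint:
  assumes "in_box s B"
  shows "contacts d s B \<inter> edge_starts d B = {}"
proof (rule equals0I)
  fix c assume "c \<in> contacts d s B \<inter> edge_starts d B"
  then obtain c' b where "c' \<in> B" "wrap d s c c'" "b \<in> B" "nb d c b" "c \<in> B"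
    by (auto simp: contacts_def edge_starts_def)
  then show False using assms by (cases d) (force simp: in_box_def)+
qed

text \<open>By \<open>nb_pdiv_pmod\<close>, edges are internal to a block or cross between blocks
  along an edge of \<open>Q\<close>; this turns edge counts into sums of products.\<close>

lemma edge_starts_blow:
  assumes box: "in_box s B" and s: "s > 0"
  shows "edge_starts d (blow s B Q) =
    blow s (edge_starts d B) Q \<union> blow s (contacts d s B) (edge_starts d Q)"
proof
  show "edge_starts d (blow s B Q) \<subseteq> blow s (edge_starts d B) Q \<union> blow s (contacts d s B) (edge_starts d Q)"
  proof
    fix a assume "a \<in> edge_starts d (blow s B Q)"
    then obtain b where "a \<in> blow s B Q" "b \<in> blow s B Q" "nb d a b"
      by (auto simp: edge_starts_def)
    then show "a \<in> blow s (edge_starts d B) Q \<union> blow s (contacts d s B) (edge_starts d Q)"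
      using nb_pdiv_pmod[OF s, of d a b]
      unfolding blow_def edge_starts_def contacts_def by blast
  qed
  show "blow s (edge_starts d B) Q \<union> blow s (contacts d s B) (edge_starts d Q) \<subseteq> edge_starts d (blow s B Q)"
  proof
    fix a assume a: "a \<in> blow s (edge_starts d B) Q \<union> blow s (contacts d s B) (edge_starts d Q)"
    then obtain q c where qc: "q \<in> Q" "c \<in> B" "(pdiv s a = q \<and> nb d (pmod s a) c) \<or>
        (nb d (pdiv s a) q \<and> wrap d s (pmod s a) c)"
      unfolding blow_def edge_starts_def contacts_def by blast
    have "nb d a (plift s q c)"
      using qc(3) unfolding nb_pdiv_pmod[OF s, of d a] pdiv_plift[OF qc(2) box] pmod_plift[OF qc(2) box] .
    moreover have "plift s q c \<in> blow s B Q" using mem_blow_plift[OF box qc(2)] qc(1) by simp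
    moreover have "a \<in> blow s B Q" using a by (auto simp: blow_def edge_starts_def contacts_def)
    ultimately show "a \<in> edge_starts d (blow s B Q)" by (auto simp: edge_starts_def)
  qed
qed

lemma card_edge_starts_blow:
  assumes box: "in_box s B" and s: "s > 0" and fin: "finite B" "finite Q"
  shows "card (edge_starts d (blow s B Q)) =
    card Q * card (edge_starts d B) + card (edge_starts d Q) * card (contacts d s B)"
proof -
  have box1: "in_box s (edge_starts d B)" "in_box s (contacts d s B)"
    using in_box_mono[OF box edge_starts_subset] in_box_mono[OF box contacts_subset] .
  have "blow s (edge_starts d B) Q \<inter> blow s (contacts d s B) (edge_starts d Q) = {}"
    using contacts_edge_starts_disjoint[OF box, of d] by (auto simp: blow_def)
  moreover have "finite (edge_starts d B)" "finite (contacts d s B)" "finite (edge_starts d Q)"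
    using fin by (auto simp: edge_starts_def contacts_def)
  ultimately show ?thesis
    unfolding edge_starts_blow[OF box s]
    by (subst card_Un_disjoint) (simp_all add: finite_blow box1 fin card_blow)
qed

lemma edges_blow:
  assumes "in_box s B" "s > 0" "finite B" "finite Q"
  shows "edges (blow s B Q) = card Q * edges B +
    card (edge_starts East Q) * card (contacts East s B) + card (edge_starts North Q) * card (contacts North s B)"
  by (simp add: edges_def card_edge_starts_blow[OF assms] algebra_simps)

text \<open>Passing to the facing place is a bijection between the contacts of opposite
  sides.\<close>

lemma card_contacts_opp: "card (contacts (opp d) s B) = card (contacts d s B)"
proof -
  define f where "f c = (THE c'. wrap d s c c')" for c
  have f: "f c = c'" if "wrap d s c c'" for c c'
    unfolding f_def using that wrap_unique by blast
  have "bij_betw f (contacts d s B) (contacts (opp d) s B)"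
    unfolding bij_betw_def
  proof
    show "inj_on f (contacts d s B)"
    proof (rule inj_onI)
      fix a b assume ab: "a \<in> contacts d s B" "b \<in> contacts d s B" "f a = f b"
      then obtain a' b' where w: "wrap d s a a'" "wrap d s b b'" by (auto simp: contacts_def)
      then have "a' = b'" using ab(3) f by simp
      then show "a = b" using w wrap_unique[of "opp d" s a' a b] by (simp add: wrap_opp)
    qed
    show "f ` contacts d s B = contacts (opp d) s B"
      unfolding contacts_def using f by (force simp: wrap_opp image_iff)
  qed
  then show ?thesis by (simp add: bij_betw_same_card)
qed

lemma pdiv_pdiv: "pdiv t (pdiv s a) = pdiv (s * t) a"
  by (simp add: pdiv_def div_mult2_eq)

lemma pmod_pmod: "pmod s (pmod (s * t) a) = pmod s a"
  by (simp add: pmod_def mod_mult2_eq)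

lemma pdiv_pmod: "s > 0 \<Longrightarrow> pdiv s (pmod (s * t) a) = pmod t (pdiv s a)"
  by (simp add: pmod_def pdiv_def mod_mult2_eq)

lemma blow_blow: "s > 0 \<Longrightarrow> blow s B (blow t C Q) = blow (s * t) (blow s B C) Q"
  by (auto simp: blow_def pdiv_pdiv pmod_pmod pdiv_pmod)

lemma in_box_blow:
  assumes "in_box t Q" "s > 0"
  shows "in_box (s * t) (blow s B Q)"
proof -
  have "x < s * t" if "x div s < t" for x :: nat
    using that assms(2) by (simp add: div_less_iff_less_mult mult.commute)
  then show ?thesis using assms(1) by (force simp: in_box_def blow_def pdiv_def)
qed

text \<open>Being first or last at scale \<open>s * t\<close> means being so at both scales; hence
  contact numbers multiply under substitution.\<close>

lemma wrap_pdiv_pmod: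
  assumes "s > 0" "t > 0"
  shows "wrap d (s * t) a b \<longleftrightarrow> wrap d t (pdiv s a) (pdiv s b) \<and> wrap d s (pmod s a) (pmod s b)"
proof -
  have top: "x = s * t - 1 \<longleftrightarrow> x div s = t - 1 \<and> x mod s = s - 1" for x :: nat
  proof -
    have eq: "s * t - 1 = s * (t - 1) + (s - 1)"
      using assms by (cases t; cases s) auto
    have dm: "(s * m + r) div s = m" "(s * m + r) mod s = r" if "r < s" for m r :: nat
      using that by simp_all
    have "s - 1 < s" using assms(1) by simp
    from dm[OF this, of "t - 1"] have "(s * t - 1) div s = t - 1" "(s * t - 1) mod s = s - 1"
      unfolding eq .
    then show ?thesis using eq_div_mod_iff[of x "s * t - 1" s] by simp
  qed
  have zero: "x = 0 \<longleftrightarrow> x div s = 0 \<and> x mod s = 0" for x :: nat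
    using eq_div_mod_iff[of x 0 s] by simp
  note eqs = eq_div_mod_iff[of "fst b" "fst a" s] eq_div_mod_iff[of "snd b" "snd a" s]
  show ?thesis
  proof (cases d)
    case East
    show ?thesis unfolding East wrap.simps top[of "fst a"] zero[of "fst b"] eqs
      by (auto simp: pdiv_def pmod_def)
  next
    case West
    show ?thesis unfolding West wrap.simps top[of "fst b"] zero[of "fst a"] eqs
      by (auto simp: pdiv_def pmod_def)
  next
    case North
    show ?thesis unfolding North wrap.simps top[of "snd a"] zero[of "snd b"] eqs
      by (auto simp: pdiv_def pmod_def)
  next
    case South
    show ?thesis unfolding South wrap.simps top[of "snd b"] zero[of "snd a"] eqs
      by (auto simp: pdiv_def pmod_def)
  qed
qed

lemma contacts_blow:
  assumes "s > 0" "t > 0" "in_box s B"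
  shows "contacts d (s * t) (blow s B C) = blow s (contacts d s B) (contacts d t C)"
proof
  show "contacts d (s * t) (blow s B C) \<subseteq> blow s (contacts d s B) (contacts d t C)"
    using wrap_pdiv_pmod[OF assms(1,2), of d] unfolding contacts_def blow_def by blast
  show "blow s (contacts d s B) (contacts d t C) \<subseteq> contacts d (s * t) (blow s B C)"
  proof
    fix a assume a: "a \<in> blow s (contacts d s B) (contacts d t C)"
    then obtain q c where qc: "q \<in> C" "c \<in> B" "wrap d t (pdiv s a) q" "wrap d s (pmod s a) c"
      by (auto simp: blow_def contacts_def)
    have "wrap d (s * t) a (plift s q c)"
      using qc(3,4) unfolding wrap_pdiv_pmod[OF assms(1,2)] pdiv_plift[OF qc(2) assms(3)]
        pmod_plift[OF qc(2) assms(3)] by blast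
    moreover have "plift s q c \<in> blow s B C" using mem_blow_plift[OF assms(3) qc(2)] qc(1) by simp
    moreover have "a \<in> blow s B C" using a by (auto simp: contacts_def blow_def)
    ultimately show "a \<in> contacts d (s * t) (blow s B C)"
      unfolding contacts_def by blast
  qed
qed

lemma card_contacts_blow:
  assumes "s > 0" "t > 0" "in_box s B"
  shows "card (contacts d (s * t) (blow s B C)) = card (contacts d t C) * card (contacts d s B)"
  using assms contacts_subset by (simp add: contacts_blow card_blow in_box_mono)

text \<open>Since \<open>u\<close> and \<open>b\<close> lie in different blocks, the edge between
  them projects to an edge of blocks leaving \<open>Q\<close> and runs between contacts.\<close>

lemma blow_boundary:
  assumes s: "s > 0" and "u \<in> blow s B Q" "b \<in> blow s B V" "b \<notin> blow s B Q" "nb d u b"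
  shows "nb d (pdiv s u) (pdiv s b)" "pdiv s b \<in> V" "pdiv s b \<notin> Q" "pdiv s u \<in> Q"
    "pmod s u \<in> contacts d s B" "pmod s b \<in> contacts (opp d) s B"
proof -
  have "pdiv s u \<noteq> pdiv s b" using assms by (auto simp: blow_def)
  then show "nb d (pdiv s u) (pdiv s b)" "pdiv s b \<in> V" "pdiv s b \<notin> Q" "pdiv s u \<in> Q"
    "pmod s u \<in> contacts d s B" "pmod s b \<in> contacts (opp d) s B"
    using nb_imp_wrap[OF assms(5) s] assms(2-4) by (auto simp: blow_def contacts_def wrap_opp)
qed

section \<open>The levels of the fractal\<close>

locale generator =
  fixes g :: nat and G :: "pt set"
  assumes g: "1 < g" and gen: "is_generator g G"
begin

definition T :: "pt set" where "T = fractal g G"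

text \<open>The level of side \<open>g ^ n\<close>, starting from the origin alone, so the index is
  one ahead of \<open>fractal_level\<close>. Points are refined here, whereas
  \<open>fractal_level\<close> attaches copies.\<close>

fun X :: "nat \<Rightarrow> pt set" where
  "X 0 = {(0, 0)}"
| "X (Suc n) = blow g G (X n)"

abbreviation con :: "dir \<Rightarrow> pt set" where "con d \<equiv> contacts d g G"

lemma g0: "g > 0" using g by simp

lemma gn0: "g ^ n > 0" using g by simp

lemma G_sub_square: "G \<subset> {0..<g} \<times> {0..<g}"
  using gen unfolding is_generator_def by blast

lemma box_G: "in_box g G"
  using psubset_imp_subset[OF G_sub_square] by (auto simp: in_box_def)

lemma fin_G: "finite G"
  using finite_subset[OF psubset_imp_subset[OF G_sub_square]] by simp

lemma zero_G: "(0, 0) \<in> G"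
  using gen unfolding is_generator_def by blast

lemma G_less: "c \<in> G \<Longrightarrow> fst c < g \<and> snd c < g"
  using box_G by (auto simp: in_box_def)

lemma box_X: "in_box (g ^ n) (X n)"
  by (induction n) (simp_all add: in_box_blow g0, simp add: in_box_def)

lemma fin_X: "finite (X n)"
  by (induction n) (simp_all add: finite_blow box_G fin_G)

lemma blow_unit: "blow (Suc 0) {(0, 0)} Q = Q"
  by (simp add: blow_def pdiv_def pmod_def)

lemma X_one: "X (Suc 0) = G"
proof
  show "X (Suc 0) \<subseteq> G"
    by (auto simp: blow_def pdiv_def pmod_def div_eq_0_iff)
  show "G \<subseteq> X (Suc 0)"
    using G_less by (force simp: blow_def pdiv_def pmod_def)
qed

text \<open>Associativity of substitution turns the refinement of points into the attachment of
  copies of a level, which is the recursion of \<open>fractal_level\<close>.\<close>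

lemma X_Suc: "X (Suc n) = blow (g ^ n) (X n) G"
proof (induction n)
  case 0
  then show ?case using X_one blow_unit by simp
next
  case (Suc n)
  have "X (Suc (Suc n)) = blow g G (blow (g ^ n) (X n) G)" using Suc by simp
  also have "\<dots> = blow (g ^ Suc n) (X (Suc n)) G" by (simp add: blow_blow g0)
  finally show ?case .
qed

lemma fractal_level_eq: "fractal_level g G n = X (Suc n)"
proof (induction n)
  case 0
  then show ?case using X_one by simp
next
  case (Suc n)
  have "set_plus_scaled (X (Suc n)) k G = {plift k q c |q c. q \<in> G \<and> c \<in> X (Suc n)}" for k
    unfolding set_plus_scaled_def plift_def by (auto simp: add.commute)
  then show ?case
    unfolding fractal_level.simps Suc.IH X_Suc[of "Suc n"] blow_eq_image[OF box_X] by auto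
qed

lemma X_mono: "X n \<subseteq> X (Suc n)"
proof (induction n)
  case 0
  then show ?case using X_one zero_G by simp
next
  case (Suc n)
  then show ?case by (auto simp: blow_def)
qed

lemma T_eq: "T = (\<Union>n. X n)"
proof -
  have "T = (\<Union>n. X (Suc n))" unfolding T_def fractal_def fractal_level_eq ..
  also have "\<dots> = (\<Union>n. X n)" using X_mono by blast
  finally show ?thesis .
qed

lemma X_le: "m \<le> n \<Longrightarrow> X m \<subseteq> X n"
  using X_mono by (rule lift_Suc_mono_le)

lemma X_sub_T: "X n \<subseteq> T" by (auto simp: T_eq)

lemma G_sub_T: "G \<subseteq> T" using X_sub_T[of "Suc 0"] X_one by simp

lemma zero_T: "(0, 0) \<in> T" using zero_G G_sub_T by blast

lemma T_blow_g: "blow g G T = T"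
proof -
  have "blow g G T = (\<Union>n. X (Suc n))" by (auto simp: T_eq blow_def)
  also have "\<dots> = T" unfolding T_eq using X_mono by blast
  finally show ?thesis .
qed

text \<open>Self-similarity at every scale: this is what lets each point of \<open>T\<close> stand
  for a copy of \<open>X n\<close>.\<close>

lemma T_blow: "blow (g ^ n) (X n) T = T"
proof (induction n)
  case 0
  then show ?case by (simp add: blow_unit)
next
  case (Suc n)
  have "blow (g ^ Suc n) (X (Suc n)) T = blow g G (blow (g ^ n) (X n) T)"
    by (simp add: blow_blow g0)
  then show ?case using Suc T_blow_g by simp
qed

lemma mem_T_iff: "a \<in> T \<longleftrightarrow> pdiv g a \<in> T \<and> pmod g a \<in> G"
  using T_blow_g by (auto simp: blow_def)

lemma plift_T: "q \<in> T \<Longrightarrow> c \<in> G \<Longrightarrow> plift g q c \<in> T"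
  using mem_blow_plift[OF box_G] T_blow_g by blast

text \<open>\<open>X n\<close> is the block over the origin, so the block lemmas apply to it with a
  one-point set.\<close>

lemma X_blow_self: "X n = blow (g ^ n) (X n) {(0, 0)}"
proof -
  have "pdiv (g ^ n) a = (0, 0) \<and> pmod (g ^ n) a = a" if "a \<in> X n" for a
    using box_X that by (auto simp: in_box_def pdiv_def pmod_def)
  moreover have "pmod (g ^ n) a = a" if "pdiv (g ^ n) a = (0, 0)" for a
    using that gn0[of n] by (cases a) (auto simp: pdiv_def pmod_def div_eq_0_iff)
  ultimately show ?thesis by (force simp: blow_def)
qed

lemma card_X: "card (X n) = card G ^ n"
  by (induction n) (simp_all add: card_blow box_G)

lemma card_contacts_X: "card (contacts d (g ^ n) (X n)) = card (con d) ^ n"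
proof (induction n)
  case 0
  have "contacts d (Suc 0) {(0, 0)} = {(0, 0)}" by (cases d) (auto simp: contacts_def)
  then show ?case by simp
next
  case (Suc n)
  then show ?case by (simp add: card_contacts_blow g0 box_G)
qed

end

section \<open>Sufficiency: trees from single bridges\<close>

lemma tree_Suc_edges:
  assumes "finite V" "V \<noteq> {}" "grid_tree V"
  shows "Suc (edges V) = card V"
proof -
  obtain r where r: "r \<in> V" using assms(2) by blast
  have conn: "grid_connected V" and acyc: "grid_acyclic V"
    using assms(3) by (auto simp: grid_tree_def)
  obtain p \<delta> where pm: "parent_map V r p \<delta>" using parent_map_exists[OF conn r] by blast
  define P where "P = (\<lambda>u. (u, p u)) ` (V - {r})"
  have P: "P \<union> P\<inverse> \<subseteq> edge_rel V" "card (P \<union> P\<inverse>) = 2 * (card V - 1)"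
    unfolding P_def using parent_map_pairs[OF pm assms(1) subset_refl r] parent_mapD(1)[OF pm]
    by simp_all
  have "2 * (card V - 1) \<le> card (edge_rel V)"
    using card_mono[OF finite_edge_rel[OF assms(1)] P(1)] P(2) by simp
  moreover have "card (edge_rel V) \<le> 2 * (card V - 1)"
    by (rule acyclic_card_edge_rel[OF assms(1,2) acyc])
  moreover have "card V \<ge> 1" using assms(1,2) by (simp add: Suc_le_eq card_gt_0_iff)
  ultimately show ?thesis unfolding card_edge_rel[OF assms(1)] by linarith
qed

lemma nb_plift: "nb d c c' \<Longrightarrow> nb d (plift s q c) (plift s q c')"
  by (cases d) (auto simp: plift_def)

lemma nb_plift_wrap:
  assumes "s > 0" "in_box s B" "c \<in> B" "c' \<in> B" "nb d q q'" "wrap d s c c'"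
  shows "nb d (plift s q c) (plift s q' c')"
  using nb_pdiv_pmod[OF assms(1), of d "plift s q c" "plift s q' c'"] assms
  by (simp add: pdiv_plift pmod_plift)

lemma nb_imp_edge: "nb d a b \<Longrightarrow> a \<in> S \<Longrightarrow> b \<in> S \<Longrightarrow> (a, b) \<in> edge_rel S"
  unfolding edge_rel_def grid_adj_iff_nb by blast

lemma edge_imp_nb: "(a, b) \<in> edge_rel S \<Longrightarrow> a \<in> S \<and> b \<in> S \<and> (\<exists>d. nb d a b)"
  unfolding edge_rel_def grid_adj_iff_nb by blast

text \<open>A path in \<open>Q\<close> lifts to a path of blocks: cross between adjacent blocks at a
  contact, and move inside a block by connectedness of \<open>B\<close>.\<close>

lemma connected_blow:
  assumes s: "s > 0" and box: "in_box s B" and B: "grid_connected B" and Q: "grid_connected Q"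
    and con: "\<And>d. contacts d s B \<noteq> {}"
  shows "grid_connected (blow s B Q)"
proof -
  let ?R = "edge_rel (blow s B Q)"
  have mem: "plift s q c \<in> blow s B Q" if "q \<in> Q" "c \<in> B" for q c
    using mem_blow_plift[OF box that(2)] that(1) by simp
  have block: "(plift s q c, plift s q c') \<in> ?R\<^sup>*" if q: "q \<in> Q" and c: "c \<in> B" "c' \<in> B" for q c c'
  proof -
    have "(c, c') \<in> (edge_rel B)\<^sup>*" using B c by (auto simp: grid_connected_iff)
    then show ?thesis
    proof (induction rule: rtrancl_induct)
      case (step y z)
      then obtain d where d: "nb d y z" "y \<in> B" "z \<in> B" using edge_imp_nb by blast
      have "(plift s q y, plift s q z) \<in> ?R"
        by (rule nb_imp_edge[OF nb_plift[OF d(1)] mem[OF q d(2)] mem[OF q d(3)]])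
      then show ?case using step.IH by (rule rtrancl_into_rtrancl[rotated])
    qed simp
  qed
  \<comment> \<open>The claim covers all points of the block reached, so that the next step can
    start at the contact it uses.\<close>
  have main: "\<forall>c\<in>B. (a, plift s q c) \<in> ?R\<^sup>*"
    if a: "a \<in> blow s B Q" and q: "(pdiv s a, q) \<in> (edge_rel Q)\<^sup>*" for a q
    using q
  proof (induction rule: rtrancl_induct)
    case base
    show ?case
      using a block[of "pdiv s a" "pmod s a"] by (simp add: blow_def)
  next
    case (step q q')
    then obtain d where d: "nb d q q'" "q \<in> Q" "q' \<in> Q" using edge_imp_nb by blast
    obtain e e' where e: "e \<in> B" "e' \<in> B" "wrap d s e e'" using con[of d] by (auto simp: contacts_def)
    have "(plift s q e, plift s q' e') \<in> ?R"
      by (rule nb_imp_edge[OF nb_plift_wrap[OF s box e(1,2) d(1) e(3)] mem[OF d(2) e(1)] mem[OF d(3) e(2)]])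
    with step.IH e(1) have "(a, plift s q' e') \<in> ?R\<^sup>*" by (metis rtrancl_into_rtrancl)
    then show ?case using block[OF d(3) e(2)] by (metis rtrancl_trans)
  qed
  show ?thesis
    unfolding grid_connected_iff
  proof (intro ballI)
    fix a b assume ab: "a \<in> blow s B Q" "b \<in> blow s B Q"
    then have "(pdiv s a, pdiv s b) \<in> (edge_rel Q)\<^sup>*" "pmod s b \<in> B"
      using Q by (auto simp: blow_def grid_connected_iff)
    then have "(a, plift s (pdiv s b) (pmod s b)) \<in> ?R\<^sup>*" using main[OF ab(1)] by blast
    then show "(a, b) \<in> ?R\<^sup>*" by simp
  qed
qed

context generator
begin

lemma card_G_ge2: "card G \<ge> 2"
proof -
  have "{(0, 0)} \<subset> G" using gen unfolding is_generator_def by blast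
  then have "card {(0::nat, 0::nat)} < card G" by (rule psubset_card_mono[OF fin_G])
  then show ?thesis by simp
qed

lemma infinite_T: "infinite T"
proof
  assume fin: "finite T"
  have "2 ^ card T \<le> card G ^ card T" using card_G_ge2 by (rule power_mono) simp
  also have "\<dots> \<le> card T" using card_mono[OF fin X_sub_T[of "card T"]] unfolding card_X .
  finally show False using less_exp[of "card T"] by linarith
qed

text \<open>Provides the roots outside finite sets for \<open>rooted_tree_exits\<close>.\<close>

lemma ex_root: "finite S \<Longrightarrow> \<exists>r\<in>T. r \<notin> S"
  by (metis infinite_T finite_subset subsetI)

lemma finite_subset_X: "finite F \<Longrightarrow> F \<subseteq> T \<Longrightarrow> \<exists>n. F \<subseteq> X n"
proof (induction rule: finite_induct)
  case (insert x F)
  then obtain n m where "F \<subseteq> X n" "x \<in> X m" by (auto simp: T_eq)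
  then have "insert x F \<subseteq> X (max n m)"
    using X_le[of n "max n m"] X_le[of m "max n m"] by auto
  then show ?case by blast
qed simp

lemma ex_line_G: "i < g \<Longrightarrow> \<exists>c\<in>G. crd d c = i"
proof -
  assume i: "i < g"
  have "(\<forall>y<g. \<exists>x. (x, y) \<in> G) \<and> (\<forall>x<g. \<exists>y. (x, y) \<in> G)"
    using gen unfolding is_generator_def by blast
  with i obtain x y where "(x, i) \<in> G" "(i, y) \<in> G" by meson
  then show ?thesis
    by (cases "horiz d") (auto simp: crd_def intro: bexI[of _ "(x, i)"] bexI[of _ "(i, y)"])
qed

lemma con_East: "con East = (\<lambda>y. (g - 1, y)) ` {y. (0, y) \<in> G \<and> (g - 1, y) \<in> G}"
proof (intro equalityI subsetI)
  fix c assume "c \<in> con East"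
  then show "c \<in> (\<lambda>y. (g - 1, y)) ` {y. (0, y) \<in> G \<and> (g - 1, y) \<in> G}"
    by (cases c) (auto simp: contacts_def)
next
  fix c assume "c \<in> (\<lambda>y. (g - 1, y)) ` {y. (0, y) \<in> G \<and> (g - 1, y) \<in> G}"
  then obtain y where "c = (g - 1, y)" "(0, y) \<in> G" "(g - 1, y) \<in> G" by blast
  then show "c \<in> con East" by (auto simp: contacts_def intro!: bexI[of _ "(0, y)"])
qed

lemma con_North: "con North = (\<lambda>x. (x, g - 1)) ` {x. (x, 0) \<in> G \<and> (x, g - 1) \<in> G}"
proof (intro equalityI subsetI)
  fix c assume "c \<in> con North"
  then show "c \<in> (\<lambda>x. (x, g - 1)) ` {x. (x, 0) \<in> G \<and> (x, g - 1) \<in> G}"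
    by (cases c) (auto simp: contacts_def)
next
  fix c assume "c \<in> (\<lambda>x. (x, g - 1)) ` {x. (x, 0) \<in> G \<and> (x, g - 1) \<in> G}"
  then obtain x where "c = (x, g - 1)" "(x, 0) \<in> G" "(x, g - 1) \<in> G" by blast
  then show "c \<in> con North" by (auto simp: contacts_def intro!: bexI[of _ "(x, 0)"])
qed

text \<open>The condition on rows and columns makes the full square the bounding box of
  \<open>G\<close>, so bridges join the coordinates \<open>0\<close> and
  \<open>g - 1\<close>.\<close>

lemma crd_image_G: "crd d ` G = {0..<g}"
proof
  show "crd d ` G \<subseteq> {0..<g}" using G_less by (auto simp: crd_def)
  show "{0..<g} \<subseteq> crd d ` G"
  proof
    fix i assume "i \<in> {0..<g}"
    then obtain c where "c \<in> G" "crd d c = i" using ex_line_G[of i d] by auto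
    then show "i \<in> crd d ` G" by blast
  qed
qed

lemma Min_Max_upt: "Min {0..<g} = 0" "Max {0..<g} = g - 1"
  using g by (auto intro!: Min_eqI Max_eqI)

lemma box_sides: "lS G = 0" "rS G = g - 1" "bS G = 0" "tS G = g - 1"
  using crd_image_G[of East] crd_image_G[of North] Min_Max_upt
  by (simp_all add: lS_def rS_def bS_def tS_def crd_def[abs_def])

lemma nhb_eq: "nhb G = card (con East)"
proof -
  have "hbridges G = (\<lambda>y. {(0, y), (g - 1, y)}) ` {y. (0, y) \<in> G \<and> (g - 1, y) \<in> G}"
    unfolding hbridges_def box_sides by blast
  then have "nhb G = card {y. (0, y) \<in> G \<and> (g - 1, y) \<in> G}"
    unfolding nhb_def by (simp add: card_image inj_on_def doubleton_eq_iff)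
  then show ?thesis unfolding con_East by (simp add: card_image inj_on_def)
qed

lemma nvb_eq: "nvb G = card (con North)"
proof -
  have "vbridges G = (\<lambda>x. {(x, 0), (x, g - 1)}) ` {x. (x, 0) \<in> G \<and> (x, g - 1) \<in> G}"
    unfolding vbridges_def box_sides by blast
  then have "nvb G = card {x. (x, 0) \<in> G \<and> (x, g - 1) \<in> G}"
    unfolding nvb_def by (simp add: card_image inj_on_def doubleton_eq_iff)
  then show ?thesis unfolding con_North by (simp add: card_image inj_on_def)
qed

text \<open>With one contact per side, the number of edges stays one below the number of points at
  every level. Paths and cycles are finite, so connectedness and acyclicity pass from the levels to
  \<open>T\<close>.\<close>

lemma contacts_singletons_imp_tree:
  assumes "grid_tree G" "card (con East) = 1" "card (con North) = 1"
  shows "grid_tree T"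
proof -
  have "card (con d) = 1" for d
    using assms(2,3) card_contacts_opp[of East g G] card_contacts_opp[of North g G] by (cases d) auto
  then have con: "con d \<noteq> {}" for d
    by (metis card.empty zero_neq_one)
  have connX: "grid_connected (X n)" for n
  proof (induction n)
    case 0
    show ?case by (simp add: grid_connected_iff)
  next
    case (Suc n)
    then show ?case using connected_blow[OF g0 box_G _ Suc con] assms(1) by (simp add: grid_tree_def)
  qed
  have neX: "X n \<noteq> {}" for n using X_le[of 0 n] by auto
  have eG: "Suc (edges G) = card G"
    using tree_Suc_edges[OF fin_G _ assms(1)] zero_G by blast
  have edgesX: "Suc (edges (X n)) = card (X n)" for n
  proof (induction n)
    case 0
    have "edge_starts d {(0, 0)} = {}" for d by (auto simp: edge_starts_def dest: nb_neq)
    then show ?case by (simp add: edges_def)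
  next
    case (Suc n)
    have "edges (X (Suc n)) = card (X n) * edges G + edges (X n)"
      using edges_blow[OF box_G g0 fin_G fin_X, of n] assms(2,3) by (simp add: edges_def)
    then have "Suc (edges (X (Suc n))) = card (X n) * Suc (edges G)"
      using Suc by simp
    then show ?case using eG by (simp add: card_blow box_G)
  qed
  have treeX: "grid_tree (X n)" for n
    by (rule connected_card_imp_tree[OF fin_X neX connX edgesX])
  show ?thesis
    unfolding grid_tree_def
  proof
    show "grid_connected T"
      unfolding grid_connected_iff
    proof (intro ballI)
      fix u v assume "u \<in> T" "v \<in> T"
      then obtain n where "{u, v} \<subseteq> X n" using finite_subset_X[of "{u, v}"] by auto
      then have "(u, v) \<in> (edge_rel (X n))\<^sup>*" using connX[of n] by (auto simp: grid_connected_iff)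
      then show "(u, v) \<in> (edge_rel T)\<^sup>*"
        using rtrancl_mono[OF edge_rel_mono[OF X_sub_T]] by blast
    qed
    show "grid_acyclic T"
      unfolding grid_acyclic_def
    proof
      assume "\<exists>c. grid_cycle_in T c"
      then obtain c where c: "grid_cycle_in T c" by blast
      then obtain n where "set c \<subseteq> X n"
        using finite_subset_X[of "set c"] by (auto simp: grid_cycle_in_def grid_path_in_def)
      then have "grid_cycle_in (X n) c" using c by (auto simp: grid_cycle_in_def grid_path_in_def)
      then show False using treeX[of n] by (auto simp: grid_tree_def grid_acyclic_def)
    qed
  qed
qed

end

section \<open>Necessity: existence of contacts and exits from unions of blocks\<close>

locale tree_fractal = generator +
  assumes tree: "grid_tree T"
begin

lemma ex_far_T: "\<exists>a\<in>T. crd d a = g"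
proof -
  obtain c where c: "c \<in> G" "crd d c = 1" using ex_line_G[of 1 d] g by auto
  then have "c \<in> T" using G_sub_T by blast
  then have "plift g c (0, 0) \<in> T" using zero_G by (rule plift_T)
  moreover have "crd d (plift g c (0, 0)) = g" using c(2) by (auto simp: crd_def plift_def)
  ultimately show ?thesis by blast
qed

text \<open>A path from the origin to a point with coordinate \<open>g\<close> changes that
  coordinate by at most one per step, so it passes from \<open>N - 1\<close> to
  \<open>N\<close>.\<close>

lemma ex_crossing:
  assumes d: "d = East \<or> d = North" and N: "0 < N" "N \<le> g"
  shows "\<exists>a\<in>T. \<exists>b\<in>T. nb d a b \<and> crd d b = N"
proof (rule ccontr)
  assume neg: "\<not> ?thesis"
  obtain v where v: "v \<in> T" "crd d v = g" using ex_far_T by blast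
  have "((0, 0), v) \<in> (edge_rel T)\<^sup>*"
    using tree zero_T v(1) by (auto simp: grid_tree_def grid_connected_iff)
  then have "crd d v < N"
  proof (induction rule: rtrancl_induct)
    case base
    then show ?case using N by (simp add: crd_def)
  next
    case (step y z)
    then obtain d' where d': "nb d' y z" "y \<in> T" "z \<in> T" using edge_imp_nb by blast
    show ?case
    proof (rule ccontr)
      assume "\<not> crd d z < N"
      then have "nb d y z \<and> crd d z = N"
        using d'(1) step.IH d by (cases d') (auto simp: crd_def)
      then show False using neg d' by blast
    qed
  qed
  then show False using v N by simp
qed

text \<open>A crossing to coordinate \<open>g\<close> goes from one block to the next and so uses a
  contact.\<close>

lemma contacts_ne: "con d \<noteq> {}"
proof -
  have ne: "con d \<noteq> {}" if d: "d = East \<or> d = North" for d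
  proof -
    obtain a b where ab: "a \<in> T" "b \<in> T" "nb d a b" "crd d b = g" using ex_crossing[OF d, of g] g by auto
    have "pdiv g a \<noteq> pdiv g b"
      using ab(3,4) d g by (auto simp: crd_def pdiv_def)
    then have "wrap d g (pmod g a) (pmod g b)" using nb_imp_wrap[OF ab(3) g0] by blast
    then show ?thesis using ab(1,2) mem_T_iff unfolding contacts_def by blast
  qed
  have "card (con (opp d)) \<noteq> 0" if "d = East \<or> d = North" for d
    unfolding card_contacts_opp using ne[OF that] finite_subset[OF contacts_subset fin_G] by simp
  then have "con (opp d) \<noteq> {}" if "d = East \<or> d = North" for d
    using that by fastforce
  from this[of East] this[of North] show ?thesis
    using ne by (cases d) auto
qed

text \<open>A crossing from coordinate \<open>0\<close> to \<open>1\<close> stays inside one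
  block.\<close>

lemma edge_starts_ne:
  assumes "d = East \<or> d = North"
  shows "edge_starts d G \<noteq> {}"
proof -
  obtain a b where ab: "a \<in> T" "b \<in> T" "nb d a b" "crd d b = 1"
    using ex_crossing[OF assms, of 1] g by auto
  have "fst a div g = fst b div g \<and> snd a div g = snd b div g"
    using ab(3,4) assms g by (auto simp: crd_def)
  then have "pdiv g a = pdiv g b" by (simp add: pdiv_def)
  then have "nb d (pmod g a) (pmod g b)"
    using nb_pdiv_pmod[OF g0, of d a b] ab(3) nb_neq by metis
  then show ?thesis using ab(1,2) mem_T_iff unfolding edge_starts_def by blast
qed

lemma finite_con: "finite (con d)"
  by (rule finite_subset[OF contacts_subset fin_G])

lemma card_con_less: "card (con d) < card G"
proof -
  have "con d \<inter> con (opp d) = {}"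
    using g by (cases d) (auto simp: contacts_def)
  moreover have "con (opp d) \<subseteq> G" "con d \<subseteq> G" by (rule contacts_subset)+
  ultimately have "con d \<subset> G" using contacts_ne[of "opp d"] by blast
  then show ?thesis by (rule psubset_card_mono[OF fin_G])
qed

definition outer :: "dir \<Rightarrow> pt set \<Rightarrow> pt set" where
  "outer d Q = {q \<in> Q. \<exists>q'\<in>T. q' \<notin> Q \<and> nb d q q'}"

lemma exit_nb:
  assumes rt: "rooted_tree T r p \<delta>" and "u \<in> T" "u \<noteq> r"
  shows "\<exists>d. nb d u (p u)" "p u \<in> T"
  using assms parent_mapD[of T r p \<delta> u] by (auto simp: rooted_tree_def grid_adj_iff_nb)

lemma blow_sub_T: "Q \<subseteq> T \<Longrightarrow> blow (g ^ n) (X n) Q \<subseteq> T"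
  using T_blow[of n] by (auto simp: blow_def)

text \<open>An exit in direction \<open>d\<close> starts at a contact on side \<open>d\<close> of a
  block in \<open>outer d Q\<close>; the bound sums over the four sides, opposite sides having
  equally many contacts.\<close>

lemma card_exits_le:
  assumes rt: "rooted_tree T r p \<delta>" and Q: "finite Q" "Q \<subseteq> T"
    and r: "r \<notin> blow (g ^ n) (X n) Q"
  shows "card {u \<in> blow (g ^ n) (X n) Q. p u \<notin> blow (g ^ n) (X n) Q}
     \<le> card (outer East Q) * card (con East) ^ n + card (outer West Q) * card (con East) ^ n +
       (card (outer North Q) * card (con North) ^ n + card (outer South Q) * card (con North) ^ n)"
proof -
  let ?s = "g ^ n" and ?D = "{East, West, North, South}"
  let ?S = "blow ?s (X n) Q"
  define Z where "Z d = blow ?s (contacts d ?s (X n)) (outer d Q)" for d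
  have finZ: "finite (Z d)" and cardZ: "card (Z d) = card (outer d Q) * card (con d) ^ n" for d
  proof -
    have box: "in_box ?s (contacts d ?s (X n))" by (rule in_box_mono[OF box_X contacts_subset])
    have "finite (contacts d ?s (X n))" "finite (outer d Q)"
      using finite_subset[OF contacts_subset fin_X] Q(1) by (auto simp: outer_def)
    then show "finite (Z d)" unfolding Z_def by (rule finite_blow[OF box])
    show "card (Z d) = card (outer d Q) * card (con d) ^ n"
      unfolding Z_def card_blow[OF box] card_contacts_X ..
  qed
  have "{u \<in> ?S. p u \<notin> ?S} \<subseteq> (\<Union>d\<in>?D. Z d)"
  proof
    fix u assume "u \<in> {u \<in> ?S. p u \<notin> ?S}"
    then have u: "u \<in> ?S" "p u \<notin> ?S" by auto
    then have uT: "u \<in> T" "u \<noteq> r" using blow_sub_T[OF Q(2)] r by auto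
    then obtain d where d: "nb d u (p u)" using exit_nb[OF rt] by blast
    have "p u \<in> blow ?s (X n) T" using exit_nb(2)[OF rt uT] T_blow by simp
    from blow_boundary[OF gn0 u(1) this u(2) d] have "u \<in> Z d"
      unfolding Z_def blow_def outer_def by blast
    moreover have "d \<in> ?D" by (cases d) auto
    ultimately show "u \<in> (\<Union>d\<in>?D. Z d)" by blast
  qed
  then have "card {u \<in> ?S. p u \<notin> ?S} \<le> card (\<Union>d\<in>?D. Z d)"
    by (intro card_mono) (auto intro: finZ)
  also have "\<dots> \<le> (\<Sum>d\<in>?D. card (Z d))" by (rule card_UN_le) simp
  finally show ?thesis
    using card_contacts_opp[of East g G] card_contacts_opp[of North g G] unfolding cardZ by simp
qed

lemma ex_rooted:
  assumes "finite S"
  shows "\<exists>r p \<delta>. rooted_tree T r p \<delta> \<and> r \<notin> S"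
  using ex_root[OF assms] tree_imp_rooted_tree[OF tree] by blast

lemma edges_X_le:
  shows "edges (X n) < card G ^ n"
    and "card G ^ n \<le> edges (X n) + card (con East) ^ n + card (con North) ^ n"
proof -
  obtain r p \<delta> where rt: "rooted_tree T r p \<delta>" and r: "r \<notin> X n"
    using ex_rooted[OF fin_X[of n]] by blast
  have ex: "card {u \<in> X n. p u \<notin> X n} + edges (X n) = card G ^ n"
    using rooted_tree_exits[OF rt fin_X X_sub_T r] card_X by simp
  have zero: "{(0, 0)} \<subseteq> T" using zero_T by simp
  let ?h = "card (con East) ^ n" and ?w = "card (con North) ^ n"
  \<comment> \<open>The origin block has no neighbour to the west or south, so exits use two sides
    only.\<close>
  have out: "outer West {(0, 0)} = {}" "outer South {(0, 0)} = {}"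
    by (auto simp: outer_def)
  have "outer d {(0, 0)} \<subseteq> {(0, 0)}" for d by (auto simp: outer_def)
  then have "card (outer d {(0, 0)}) \<le> card {(0::nat, 0::nat)}" for d
    by (rule card_mono[rotated]) simp
  then have out1: "card (outer d {(0, 0)}) * k \<le> k" for d k
    by (metis card_1_singleton_iff One_nat_def mult_le_mono1 nat_mult_1)
  have "card {u \<in> X n. p u \<notin> X n} \<le> card (outer East {(0, 0)}) * ?h + card (outer North {(0, 0)}) * ?w"
    using card_exits_le[OF rt _ zero, of n] r unfolding X_blow_self[symmetric] out by simp
  also have "\<dots> \<le> ?h + ?w" by (intro add_mono out1)
  finally show "card G ^ n \<le> edges (X n) + ?h + ?w"
    using ex by simp
  \<comment> \<open>A point of least depth in \<open>X n\<close> has its parent outside.\<close>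
  have "\<exists>u\<in>X n. p u \<notin> X n"
  proof (rule ccontr)
    assume neg: "\<not> ?thesis"
    have "X n \<noteq> {}" using X_le[of 0 n] by auto
    then obtain u where u: "u \<in> X n" "\<forall>w\<in>X n. \<delta> u \<le> \<delta> w"
      using ex_has_least_nat[of "\<lambda>u. u \<in> X n" _ \<delta>] by blast
    then have "\<delta> u = Suc (\<delta> (p u))"
      using parent_mapD(3)[of T r p \<delta> u] rt r X_sub_T[of n] unfolding rooted_tree_def by blast
    moreover have "p u \<in> X n" using u(1) neg by blast
    ultimately show False using u(2) by fastforce
  qed
  then have "card {u \<in> X n. p u \<notin> X n} \<noteq> 0" using fin_X[of n] by auto
  then show "edges (X n) < card G ^ n" using ex by simp
qed

end

section \<open>Equally many horizontal and vertical bridges\<close>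

text \<open>The first coordinate is taken along the axis of \<open>d\<close> and the second across
  it, so that one argument covers rows and columns.\<close>

definition mk :: "dir \<Rightarrow> nat \<Rightarrow> nat \<Rightarrow> pt" where
  "mk d i j = (if horiz d then (i, j) else (j, i))"

definition forward :: "dir \<Rightarrow> bool" where
  "forward d \<longleftrightarrow> d = East \<or> d = North"

fun turn :: "dir \<Rightarrow> dir" where
  "turn East = North" | "turn West = South" | "turn North = East" | "turn South = West"

lemma mk_inj: "mk d i j = mk d i' j' \<longleftrightarrow> i = i' \<and> j = j'"
  by (auto simp: mk_def)

lemma pdiv_mk: "pdiv s (mk d i j) = mk d (i div s) (j div s)"
  by (simp add: pdiv_def mk_def)

lemma pmod_mk: "pmod s (mk d i j) = mk d (i mod s) (j mod s)"
  by (simp add: pmod_def mk_def)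

lemma mk_cases: "\<exists>i j. a = mk d i j"
  by (cases a) (auto simp: mk_def)

lemma nb_mk_iff: "forward d \<Longrightarrow> nb d (mk d x j) b \<longleftrightarrow> b = mk d (Suc x) j"
  by (cases b) (auto simp: forward_def mk_def)

lemma nb_mk_iff2: "forward d \<Longrightarrow> nb d b (mk d x j) \<longleftrightarrow> (\<exists>y. x = Suc y \<and> b = mk d y j)"
  by (cases b) (auto simp: forward_def mk_def)

lemma nb_turn_mk: "nb (turn d) (mk d x j) (mk d y j') \<Longrightarrow> j \<noteq> j'"
  by (cases d) (auto simp: mk_def)

text \<open>For \<open>w > 0\<close> the powers of \<open>h / w > 1\<close> are unbounded.\<close>

lemma power_outgrows:
  fixes w h C :: nat
  assumes "w < h"
  shows "\<exists>n. C * w ^ n < h ^ n"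
proof (cases "w = 0")
  case True
  then show ?thesis using assms by (intro exI[of _ 1]) simp
next
  case False
  then have "1 < real h / real w" using assms by simp
  then obtain n where "real C < (real h / real w) ^ n" using real_arch_pow by blast
  then have "real C * real w ^ n < real h ^ n"
    using False by (simp add: power_divide pos_less_divide_eq)
  then have "real (C * w ^ n) < real (h ^ n)" by simp
  then show ?thesis by (intro exI[of _ n]) (simp only: of_nat_less_iff)
qed

context tree_fractal
begin

text \<open>A maximal run of \<open>m\<close> points from coordinate \<open>i\<close> on the line
  \<open>j\<close>. For \<open>i = 0\<close> the last condition is vacuous: the run starts at the
  border of the quadrant.\<close>

definition run :: "dir \<Rightarrow> nat \<Rightarrow> nat \<Rightarrow> nat \<Rightarrow> bool" where
  "run d i j m \<longleftrightarrow> m > 0 \<and> (\<forall>x. i \<le> x \<and> x < i + m \<longrightarrow> mk d x j \<in> T) \<and>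
     mk d (i + m) j \<notin> T \<and> (\<forall>x. Suc x = i \<longrightarrow> mk d x j \<notin> T)"

text \<open>\<open>x\<close> is the number of exits from the blown-up run. Its two ends have no
  adjacent block, so exits use only the two long sides, each with at most \<open>m\<close>
  blocks.\<close>

lemma run_count:
  assumes d: "forward d" and run: "run d i j m"
  shows "\<exists>x. x \<le> 2 * m * card (con (turn d)) ^ n \<and>
    x + m * edges (X n) + (m - 1) * card (con d) ^ n = m * card G ^ n"
proof -
  define Q where "Q = (\<lambda>x. mk d x j) ` {i..<i + m}"
  let ?S = "blow (g ^ n) (X n) Q"
  have m: "m > 0" and inT: "\<And>x. i \<le> x \<Longrightarrow> x < i + m \<Longrightarrow> mk d x j \<in> T"
    and stop: "mk d (i + m) j \<notin> T" "\<And>x. Suc x = i \<Longrightarrow> mk d x j \<notin> T"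
    using run by (auto simp: run_def)
  have QT: "Q \<subseteq> T" and finQ: "finite Q" using inT by (auto simp: Q_def)
  have cardQ: "card Q = m" unfolding Q_def by (subst card_image) (auto simp: inj_on_def mk_inj)
  have "edge_starts d Q = (\<lambda>x. mk d x j) ` {i..<i + (m - 1)}"
  proof (intro equalityI subsetI)
    fix q assume "q \<in> edge_starts d Q"
    then obtain b where b: "q \<in> Q" "b \<in> Q" "nb d q b"
      unfolding edge_starts_def by blast
    obtain x where x: "q = mk d x j" "i \<le> x" "x < i + m"
      using b(1) by (auto simp: Q_def)
    then have "mk d (Suc x) j \<in> Q" using nb_mk_iff[OF d] b by simp
    then have "Suc x < i + m" by (auto simp: Q_def mk_inj)
    then show "q \<in> (\<lambda>x. mk d x j) ` {i..<i + (m - 1)}" using x by auto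
  next
    fix q assume "q \<in> (\<lambda>x. mk d x j) ` {i..<i + (m - 1)}"
    then obtain x where x: "q = mk d x j" "i \<le> x" "x < i + (m - 1)" by auto
    then have "q \<in> Q" "mk d (Suc x) j \<in> Q" by (auto simp: Q_def)
    then show "q \<in> edge_starts d Q" using nb_mk_iff[OF d, of x j] x(1) by (auto simp: edge_starts_def)
  qed
  then have e1: "card (edge_starts d Q) = m - 1"
    by (simp add: card_image inj_on_def mk_inj)
  have "edge_starts (turn d) Q = {}"
    using nb_turn_mk by (fastforce simp: edge_starts_def Q_def)
  then have e2: "card (edge_starts (turn d) Q) = 0" by simp
  have edges: "edges ?S = m * edges (X n) + (m - 1) * card (con d) ^ n"
    using edges_blow[OF box_X gn0 fin_X finQ, of n] e1 e2 cardQ d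
    by (auto simp: forward_def card_contacts_X)
  have o1: "outer d Q = {}"
  proof (rule equals0I)
    fix q assume "q \<in> outer d Q"
    then obtain x q' where x: "q = mk d x j" "i \<le> x" "x < i + m" "q' \<in> T" "q' \<notin> Q" "nb d q q'"
      by (auto simp: outer_def Q_def)
    then have q': "q' = mk d (Suc x) j" using nb_mk_iff[OF d] by simp
    with x have "\<not> Suc x < i + m" by (auto simp: Q_def)
    then have "Suc x = i + m" using x by simp
    then show False using stop(1) x(4) q' by simp
  qed
  have o2: "outer (opp d) Q = {}"
  proof (rule equals0I)
    fix q assume "q \<in> outer (opp d) Q"
    then obtain x q' where x: "q = mk d x j" "i \<le> x" "x < i + m" "q' \<in> T" "q' \<notin> Q" "nb d q' q"
      by (auto simp: outer_def Q_def nb_opp)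
    then obtain y where y: "x = Suc y" "q' = mk d y j" using nb_mk_iff2[OF d] by auto
    with x have "\<not> i \<le> y" by (auto simp: Q_def)
    then have "Suc y = i" using x y by simp
    then show False using stop(2) x(4) y(2) by simp
  qed
  have o3: "card (outer d' Q) \<le> m" for d'
    using card_mono[OF finQ, of "outer d' Q"] cardQ by (auto simp: outer_def)
  obtain r p \<delta> where rt: "rooted_tree T r p \<delta>" and r: "r \<notin> ?S"
    using ex_rooted[OF finite_blow[OF box_X fin_X finQ]] by blast
  let ?x = "card {u \<in> ?S. p u \<notin> ?S}" and ?W = "card (con (turn d)) ^ n"
  have "?x \<le> card (outer (turn d) Q) * ?W + card (outer (opp (turn d)) Q) * ?W"
    using card_exits_le[OF rt finQ QT r] o1 o2 d by (auto simp: forward_def)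
  also have "\<dots> \<le> m * ?W + m * ?W" by (intro add_mono mult_le_mono1 o3)
  finally have "?x \<le> 2 * m * ?W" by simp
  moreover have "?x + edges ?S = m * card G ^ n"
    using rooted_tree_exits[OF rt finite_blow[OF box_X fin_X finQ] blow_sub_T[OF QT] r]
    by (simp add: card_blow box_X cardQ card_X)
  ultimately show ?thesis unfolding edges by (intro exI[of _ ?x]) simp
qed

text \<open>By \<open>run_count\<close>, \<open>m (v\<^sup>n - e) - (m - 1) h\<^sup>n\<close> is of order \<open>w\<^sup>n\<close>, with \<open>e\<close> the
  number of edges of \<open>X n\<close>; for \<open>w < h\<close> this determines \<open>m\<close>.\<close>

lemma run_length_le:
  assumes d: "forward d" and less: "card (con (turn d)) < card (con d)"
    and runs: "run d i j m" "run d i' j' m'"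
  shows "m' \<le> m"
proof (rule ccontr)
  assume "\<not> m' \<le> m"
  then have mm: "m < m'" by simp
  let ?w = "card (con (turn d))" and ?h = "card (con d)"
  \<comment> \<open>The factor comes from multiplying the bound on the exits \<open>x\<close> of the
    shorter run by \<open>m'\<close>.\<close>
  obtain n where n: "(2 * m * m') * ?w ^ n < ?h ^ n" using power_outgrows[OF less] by blast
  define H W V E where "H = int (?h ^ n)" and "W = int (?w ^ n)" and "V = int (card G ^ n)"
    and "E = int (edges (X n))"
  have m0: "m > 0" "m' > 0" using runs by (auto simp: run_def)
  obtain x where x: "x \<le> 2 * m * ?w ^ n" "x + m * edges (X n) + (m - 1) * ?h ^ n = m * card G ^ n"
    using run_count[OF d runs(1), of n] by blast
  obtain x' where x': "x' \<le> 2 * m' * ?w ^ n" "x' + m' * edges (X n) + (m' - 1) * ?h ^ n = m' * card G ^ n"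
    using run_count[OF d runs(2), of n] by blast
  have "int (m - 1) = int m - 1" "int (m' - 1) = int m' - 1" using m0 by auto
  then have "int x + int m * E + (int m - 1) * H = int m * V"
    and "int x' + int m' * E + (int m' - 1) * H = int m' * V"
    using arg_cong[OF x(2), of int] arg_cong[OF x'(2), of int]
    unfolding E_def H_def V_def of_nat_add of_nat_mult by simp_all
  \<comment> \<open>Cross-multiplication eliminates \<open>V\<close>; the terms with
    \<open>E\<close> then cancel as well.\<close>
  then have "int m' * (int x + int m * E + (int m - 1) * H) = int m * (int x' + int m' * E + (int m' - 1) * H)"
    by simp
  then have eq: "int m' * int x - int m * int x' = (int m' - int m) * H"
    by (simp add: algebra_simps)
  have "H \<ge> 0" by (simp add: H_def)
  then have "1 * H \<le> (int m' - int m) * H"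
    using mm by (intro mult_right_mono) auto
  also have "\<dots> \<le> int m' * int x" unfolding eq[symmetric] by simp
  also have "\<dots> \<le> int m' * (2 * int m * W)"
  proof (rule mult_left_mono)
    show "int x \<le> 2 * int m * W" using x(1) unfolding W_def
      by (metis of_nat_le_iff of_nat_mult of_nat_numeral)
  qed simp
  also have "\<dots> = int ((2 * m * m') * ?w ^ n)" by (simp add: W_def)
  finally have "int (?h ^ n) \<le> int ((2 * m * m') * ?w ^ n)" unfolding H_def mult_1_left .
  then show False using n by (simp only: of_nat_le_iff)
qed

lemma mem_T_mk: "mk d x j \<in> T \<longleftrightarrow> mk d (x div g) (j div g) \<in> T \<and> mk d (x mod g) (j mod g) \<in> G"
  unfolding mem_T_iff[of "mk d x j"] pdiv_mk pmod_mk ..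

lemma mem_T_mk_add:
  assumes "r < g" "\<eta> < g"
  shows "mk d (g * i + r) (g * j + \<eta>) \<in> T \<longleftrightarrow> mk d i j \<in> T \<and> mk d r \<eta> \<in> G"
  using assms mem_T_mk[of d "g * i + r" "g * j + \<eta>"] by simp

text \<open>Otherwise every point of \<open>T\<close> continues forever in direction
  \<open>d\<close>. Each line meets \<open>G\<close>, so the block after the origin block would be
  full and \<open>G\<close> the whole square.\<close>

lemma ex_last:
  assumes d: "forward d"
  shows "\<exists>i j. mk d i j \<in> T \<and> mk d (Suc i) j \<notin> T"
proof (rule ccontr)
  assume neg: "\<not> ?thesis"
  have right: "mk d (i + k) j \<in> T" if "mk d i j \<in> T" for i j k
    using that neg by (induction k) auto
  have "mk d x y \<in> G" if xy: "x < g" "y < g" for x y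
  proof -
    obtain c where c: "c \<in> G" "crd (turn d) c = y" using ex_line_G[OF xy(2)] by blast
    obtain x0 where x0: "c = mk d x0 y"
      using c(2) d by (cases c) (auto simp: forward_def crd_def mk_def)
    have "x0 < g" using G_less[OF c(1)] x0 by (auto simp: mk_def split: if_splits)
    have "mk d x0 y \<in> T" using c(1) x0 G_sub_T by blast
    \<comment> \<open>The shift leads to coordinate \<open>g + x\<close>; as \<open>x0 < g\<close>,
      the subtraction is not truncated.\<close>
    then have "mk d (x0 + (g + x - x0)) y \<in> T" by (rule right)
    then have "mk d (g * 1 + x) (g * 0 + y) \<in> T" using \<open>x0 < g\<close> by simp
    then show "mk d x y \<in> G" using mem_T_mk_add[OF xy] by blast
  qed
  then have "(a, b) \<in> G" if "a < g" "b < g" for a b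
    using that by (cases "horiz d") (auto simp: mk_def)
  then have "{0..<g} \<times> {0..<g} \<subseteq> G" by auto
  then show False using G_sub_square by blast
qed

lemma ex_run:
  assumes "mk d i j \<in> T" "mk d (Suc i) j \<notin> T"
  shows "\<exists>a m. a + m = Suc i \<and> run d a j m"
proof -
  define P where "P a \<longleftrightarrow> a \<le> i \<and> (\<forall>x. a \<le> x \<and> x \<le> i \<longrightarrow> mk d x j \<in> T)" for a
  define a where "a = (LEAST a. P a)"
  have "P i" using assms by (auto simp: P_def)
  then have Pa: "P a" and least: "\<And>b. P b \<Longrightarrow> a \<le> b" unfolding a_def by (auto intro: LeastI Least_le)
  have "mk d x j \<notin> T" if "Suc x = a" for x
  proof
    assume x: "mk d x j \<in> T"
    have "P x"
      unfolding P_def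
    proof (intro conjI allI impI)
      show "x \<le> i" using Pa that by (simp add: P_def)
      fix y assume "x \<le> y \<and> y \<le> i"
      then show "mk d y j \<in> T" using Pa x that by (cases "y = x") (auto simp: P_def)
    qed
    then show False using least that by fastforce
  qed
  then have "run d a j (Suc i - a)" using Pa assms by (auto simp: run_def P_def)
  moreover have "a + (Suc i - a) = Suc i" using Pa by (simp add: P_def)
  ultimately show ?thesis by blast
qed

text \<open>In the row (or column) of a bridge, a block without a successor and a block with a successor
  end in runs of different lengths, unless that row of \<open>G\<close> is full; then runs are stretched by the
  factor \<open>g\<close>.\<close>

lemma two_runs:
  assumes d: "forward d"
  shows "\<exists>i j m i' j' m'. run d i j m \<and> run d i' j' m' \<and> m \<noteq> m'"
proof -
  obtain i0 j0 where last: "mk d i0 j0 \<in> T" "mk d (Suc i0) j0 \<notin> T" using ex_last[OF d] by blast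
  \<comment> \<open>\<open>\<eta>\<close> is the line of a bridge.\<close>
  obtain \<eta> where \<eta>: "mk d (g - 1) \<eta> \<in> G" "mk d 0 \<eta> \<in> G"
  proof -
    obtain c c' where c: "c \<in> G" "c' \<in> G" "wrap d g c c'" using contacts_ne[of d] by (auto simp: contacts_def)
    obtain a b where ab: "c = mk d a b" using mk_cases by blast
    have "c = mk d (g - 1) b" "c' = mk d 0 b"
      using c(3) d ab by (cases c; cases c'; auto simp: forward_def mk_def)+
    then show ?thesis using that c by blast
  qed
  have \<eta>g: "\<eta> < g" using G_less[OF \<eta>(1)] by (auto simp: mk_def split: if_splits)
  note mem = mem_T_mk_add[OF _ \<eta>g]
  show ?thesis
  proof (cases "\<forall>x<g. mk d x \<eta> \<in> G")
    case full: True
    obtain a m where am: "a + m = Suc i0" and run: "run d a j0 m" using ex_run[OF last] by blast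
    \<comment> \<open>On a full line each point of the run becomes \<open>g\<close> consecutive
      points.\<close>
    have "run d (g * a) (g * j0 + \<eta>) (g * m)"
      unfolding run_def
    proof (intro conjI allI impI)
      show "0 < g * m" using run g0 by (simp add: run_def)
      have memx: "mk d x (g * j0 + \<eta>) \<in> T \<longleftrightarrow> mk d (x div g) j0 \<in> T" for x
        using mem[of "x mod g" d "x div g" j0] full g0 by simp
      show "mk d x (g * j0 + \<eta>) \<in> T" if x: "g * a \<le> x \<and> x < g * a + g * m" for x
      proof -
        have "a \<le> x div g" using x g0 by (simp add: less_eq_div_iff_mult_less_eq mult.commute)
        moreover have "x div g < a + m"
          using x g0 by (simp add: div_less_iff_less_mult algebra_simps)
        ultimately show ?thesis unfolding memx using run by (auto simp: run_def)
      qed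
      have "(g * a + g * m) div g = a + m"
        using g0 by (metis distrib_left nonzero_mult_div_cancel_left not_less_zero)
      then show "mk d (g * a + g * m) (g * j0 + \<eta>) \<notin> T"
        unfolding memx using run by (simp add: run_def)
      show "mk d x (g * j0 + \<eta>) \<notin> T" if x: "Suc x = g * a" for x
      proof -
        obtain b where b: "a = Suc b" using x by (cases a) auto
        obtain r where r: "g = Suc r" using g0 by (cases g) auto
        have "x = g * b + r" using x unfolding b r by simp
        moreover have "(g * b + r) div g = b" unfolding r by (simp del: mult_Suc)
        ultimately have "x div g = b" by simp
        then show ?thesis unfolding memx using run b by (simp add: run_def)
      qed
    qed
    moreover have "m \<noteq> g * m" using run g by (auto simp: run_def)
    ultimately show ?thesis using run by blast
  next
    case False
    then obtain x0 where x0: "x0 < g" "mk d x0 \<eta> \<notin> G" by blast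
    \<comment> \<open>\<open>\<beta>\<close> is the first gap of the line and, below,
      \<open>\<alpha>\<close> the last one; both are interior because the ends belong to a
      bridge.\<close>
    obtain \<beta> where \<beta>: "\<beta> < g" "mk d \<beta> \<eta> \<notin> G" "\<And>x. x < \<beta> \<Longrightarrow> mk d x \<eta> \<in> G"
      using exists_least_iff[of "\<lambda>x. mk d x \<eta> \<notin> G"] x0 by (metis le_less_trans not_le_imp_less)
    have \<beta>0: "\<beta> > 0" using \<beta>(2) \<eta>(2) by (cases \<beta>) auto
    obtain \<alpha> where \<alpha>: "\<alpha> < g" "mk d \<alpha> \<eta> \<notin> G" "\<And>x. \<alpha> < x \<Longrightarrow> x < g \<Longrightarrow> mk d x \<eta> \<in> G"
    proof -
      define A where "A = {x. x < g \<and> mk d x \<eta> \<notin> G}"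
      have fin: "finite A" and ne: "A \<noteq> {}" using x0 by (auto simp: A_def)
      have MA: "Max A < g" "mk d (Max A) \<eta> \<notin> G" using Max_in[OF fin ne] unfolding A_def by blast+
      have "mk d x \<eta> \<in> G" if "Max A < x" "x < g" for x
      proof -
        have "x \<notin> A" using Max_ge[OF fin, of x] that(1) by linarith
        then show ?thesis using that(2) by (simp add: A_def)
      qed
      then show ?thesis by (rule that[OF MA])
    qed
    have \<alpha>1: "Suc \<alpha> < g" using \<alpha>(1,2) \<eta>(1) by (metis Suc_lessI diff_Suc_1)
    \<comment> \<open>Over a point without successor, the run after the last gap stops at the end of
      the block.\<close>
    have run1: "run d (g * i0 + Suc \<alpha>) (g * j0 + \<eta>) (g - Suc \<alpha>)"
      unfolding run_def
    proof (intro conjI allI impI)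
      show "0 < g - Suc \<alpha>" using \<alpha>1 by simp
      show "mk d x (g * j0 + \<eta>) \<in> T"
        if x: "g * i0 + Suc \<alpha> \<le> x \<and> x < g * i0 + Suc \<alpha> + (g - Suc \<alpha>)" for x
      proof -
        obtain r where r: "x = g * i0 + r" using x by (metis add_leD1 le_Suc_ex)
        then have "\<alpha> < r" "r < g" using x by auto
        then show ?thesis unfolding r using mem[of r d i0 j0] \<alpha>(3) last(1) by simp
      qed
      have "g * i0 + Suc \<alpha> + (g - Suc \<alpha>) = g * Suc i0 + 0" using \<alpha>1 by simp
      then show "mk d (g * i0 + Suc \<alpha> + (g - Suc \<alpha>)) (g * j0 + \<eta>) \<notin> T"
        using mem[of 0 d "Suc i0" j0] last(2) g0 by metis
      show "mk d x (g * j0 + \<eta>) \<notin> T" if "Suc x = g * i0 + Suc \<alpha>" for x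
      proof -
        have "x = g * i0 + \<alpha>" using that by simp
        then show ?thesis using mem[OF \<alpha>(1), of d i0 j0] \<alpha>(2) by simp
      qed
    qed
    obtain i1 j1 where nxt: "mk d i1 j1 \<in> T" "mk d (Suc i1) j1 \<in> T"
    proof -
      obtain a b where ab: "a \<in> T" "b \<in> T" "nb d a b"
        using ex_crossing[of d 1] d g by (auto simp: forward_def)
      obtain i j where ij: "a = mk d i j" using mk_cases by blast
      then have "b = mk d (Suc i) j" using nb_mk_iff[OF d] ab(3) by simp
      then show ?thesis using that ab ij by blast
    qed
    \<comment> \<open>Over a point with a successor, the run goes on through the first
      \<open>\<beta>\<close> places of the next block.\<close>
    have "run d (g * i1 + Suc \<alpha>) (g * j1 + \<eta>) (g - Suc \<alpha> + \<beta>)"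
      unfolding run_def
    proof (intro conjI allI impI)
      show "0 < g - Suc \<alpha> + \<beta>" using \<alpha>1 by simp
      show "mk d x (g * j1 + \<eta>) \<in> T"
        if x: "g * i1 + Suc \<alpha> \<le> x \<and> x < g * i1 + Suc \<alpha> + (g - Suc \<alpha> + \<beta>)" for x
      proof -
        obtain r where r: "x = g * i1 + r" using x by (metis add_leD1 le_Suc_ex)
        then have r1: "\<alpha> < r" "r < g + \<beta>" using x \<alpha>1 by auto
        show ?thesis
        proof (cases "r < g")
          case True
          then show ?thesis unfolding r using mem[of r d i1 j1] \<alpha>(3) r1(1) nxt(1) by simp
        next
          case False
          then have "x = g * Suc i1 + (r - g)" "r - g < \<beta>" using r r1 by auto
          then show ?thesis using mem[of "r - g" d "Suc i1" j1] \<beta>(1,3) nxt(2) by simp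
        qed
      qed
      have "g * i1 + Suc \<alpha> + (g - Suc \<alpha> + \<beta>) = g * Suc i1 + \<beta>" using \<alpha>1 by simp
      then show "mk d (g * i1 + Suc \<alpha> + (g - Suc \<alpha> + \<beta>)) (g * j1 + \<eta>) \<notin> T"
        using mem[OF \<beta>(1), of d "Suc i1" j1] \<beta>(2) by metis
      show "mk d x (g * j1 + \<eta>) \<notin> T" if "Suc x = g * i1 + Suc \<alpha>" for x
      proof -
        have "x = g * i1 + \<alpha>" using that by simp
        then show ?thesis using mem[OF \<alpha>(1), of d i1 j1] \<alpha>(2) by simp
      qed
    qed
    moreover have "g - Suc \<alpha> \<noteq> g - Suc \<alpha> + \<beta>" using \<beta>0 by simp
    ultimately show ?thesis using run1 by blast
  qed
qed

text \<open>Otherwise all runs would have the same length by \<open>run_length_le\<close>, against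
  \<open>two_runs\<close>. Applied to both axes, this yields equality.\<close>

lemma card_con_le:
  assumes d: "forward d"
  shows "card (con d) \<le> card (con (turn d))"
proof (rule ccontr)
  assume "\<not> ?thesis"
  then have less: "card (con (turn d)) < card (con d)" by simp
  obtain i j m i' j' m' where runs: "run d i j m" "run d i' j' m'" "m \<noteq> m'"
    using two_runs[OF d] by blast
  show False
    using run_length_le[OF d less runs(1,2)] run_length_le[OF d less runs(2,1)] runs(3) by simp
qed

section \<open>The common number of bridges and the number of edges\<close>

definition k :: nat where "k = card (con East)"

lemma card_con: "card (con d) = k"
proof -
  have "card (con North) = card (con East)"
    using card_con_le[of East] card_con_le[of North] by (simp add: forward_def)
  then show ?thesis
    using card_contacts_opp[of East g G] card_contacts_opp[of North g G]
    by (cases d) (simp_all add: k_def)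
qed

lemma k_pos: "k > 0"
  using contacts_ne[of East] finite_con[of East] by (simp add: k_def card_gt_0_iff)

lemma k_less: "k < card G"
  using card_con_less[of East] by (simp add: k_def)

lemma edges_X_Suc: "edges (X (Suc n)) = card G ^ n * edges G + k * edges (X n)"
  using edges_blow[OF box_G g0 fin_G fin_X[of n]]
  by (simp add: card_con card_X edges_def algebra_simps)

text \<open>The recursion gives the edge numbers of the levels in closed form. Points minus edges of
  \<open>X n\<close> is positive and at most \<open>2 * c ^ n\<close>; as \<open>c < v\<close>, the
  coefficient of \<open>v ^ n\<close> must vanish.\<close>

lemma edges_G: "edges G + k = card G"
proof -
  define v e c where "v = int (card G)" and "e = int (edges G)" and "c = int k"
  have X0: "edges (X 0) = 0"
  proof -
    have "edge_starts d {(0, 0)} = {}" for d by (auto simp: edge_starts_def dest: nb_neq)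
    then show ?thesis by (simp add: edges_def)
  qed
  have closed: "(v - c) * int (edges (X n)) = e * (v ^ n - c ^ n)" for n
  proof (induction n)
    case 0
    then show ?case using X0 by simp
  next
    case (Suc n)
    have "(v - c) * int (edges (X (Suc n))) = (v - c) * (v ^ n * e) + c * ((v - c) * int (edges (X n)))"
      unfolding edges_X_Suc by (simp add: v_def e_def c_def algebra_simps)
    also have "\<dots> = e * (v ^ Suc n - c ^ Suc n)" unfolding Suc by (simp add: algebra_simps)
    finally show ?case .
  qed
  have vc: "v > c" "c > 0" using k_less k_pos by (auto simp: v_def c_def)
  \<comment> \<open>The coefficient of \<open>v ^ n\<close>; \<open>s = 0\<close> is the
    claim.\<close>
  define s where "s = v - c - e"
  have rest: "(v - c) * (v ^ n - int (edges (X n))) = s * v ^ n + e * c ^ n" for n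
    using closed[of n] by (simp add: s_def algebra_simps)
  have lower: "0 < s * v ^ n + e * c ^ n" for n
  proof -
    have "int (edges (X n)) < int (card G ^ n)" using edges_X_le(1)[of n] by (simp only: of_nat_less_iff)
    then have "v ^ n - int (edges (X n)) > 0" by (simp add: v_def)
    then show ?thesis unfolding rest[symmetric] using vc(1) by (intro mult_pos_pos) auto
  qed
  have upper: "s * v ^ n + e * c ^ n \<le> (v - c) * (2 * c ^ n)" for n
  proof -
    have "int (card G ^ n) \<le> int (edges (X n) + k ^ n + k ^ n)"
      using edges_X_le(2)[of n] unfolding card_con by (simp only: of_nat_le_iff)
    then have "v ^ n - int (edges (X n)) \<le> 2 * c ^ n" by (simp add: v_def c_def)
    then show ?thesis unfolding rest[symmetric] using vc(1) by (intro mult_left_mono) auto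
  qed
  have e0: "e \<ge> 0" by (simp add: e_def)
  have "s = 0"
  proof (rule ccontr)
    assume "s \<noteq> 0"
    then consider "s \<ge> 1" | "s \<le> -1" by linarith
    then show False
    proof cases
      case 1
      obtain n where n: "nat (2 * (v - c)) * k ^ n < card G ^ n" using power_outgrows[OF k_less] by blast
      have "int (nat (2 * (v - c)) * k ^ n) < int (card G ^ n)"
        using n by (simp only: of_nat_less_iff)
      moreover have "int (nat (2 * (v - c))) = 2 * (v - c)" using vc by simp
      ultimately have "2 * (v - c) * c ^ n < v ^ n"
        unfolding of_nat_mult of_nat_power v_def c_def by metis
      also have "\<dots> = 1 * v ^ n" by simp
      also have "\<dots> \<le> s * v ^ n" using 1 vc by (intro mult_right_mono) auto
      finally have "2 * (v - c) * c ^ n < s * v ^ n" .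
      moreover have "0 \<le> e * c ^ n" using e0 vc by simp
      moreover have "2 * (v - c) * c ^ n = (v - c) * (2 * c ^ n)" by simp
      ultimately show False using upper[of n] by linarith
    next
      case 2
      obtain n where n: "edges G * k ^ n < card G ^ n" using power_outgrows[OF k_less] by blast
      have "e * c ^ n < v ^ n"
        unfolding v_def c_def e_def of_nat_power[symmetric] of_nat_mult[symmetric]
        using n by (simp only: of_nat_less_iff)
      moreover have "s * v ^ n \<le> -1 * v ^ n" using 2 vc by (intro mult_right_mono) auto
      ultimately show False using lower[of n] by linarith
    qed
  qed
  then have "int (edges G + k) = int (card G)" by (simp add: s_def v_def c_def e_def)
  then show ?thesis by (simp only: of_nat_eq_iff)
qed

lemma edges_X: "edges (X n) + k ^ n = card G ^ n"
proof (induction n)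
  case 0
  have "edge_starts d {(0, 0)} = {}" for d by (auto simp: edge_starts_def dest: nb_neq)
  then show ?case by (simp add: edges_def)
next
  case (Suc n)
  have "edges (X (Suc n)) + k ^ Suc n = card G ^ n * edges G + k * (edges (X n) + k ^ n)"
    unfolding edges_X_Suc by (simp add: algebra_simps)
  also have "\<dots> = card G ^ n * (edges G + k)" unfolding Suc by (simp add: algebra_simps)
  finally show ?case unfolding edges_G by simp
qed

end

section \<open>Edges with a finite side\<close>

lemma same_axis: "horiz e = horiz d \<Longrightarrow> e = d \<or> e = opp d"
  by (cases d; cases e) auto

lemma nb_crd: "nb e a b \<Longrightarrow> horiz e \<noteq> horiz d \<Longrightarrow> crd d a = crd d b"
  by (cases e) (auto simp: crd_def)

lemma crd_eqI: "crd d a = crd d b \<Longrightarrow> crd e a = crd e b \<Longrightarrow> horiz d \<noteq> horiz e \<Longrightarrow> a = b"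
  by (auto simp: crd_def prod_eq_iff split: if_splits)

lemma contacts_same_side: "c \<in> contacts d s B \<Longrightarrow> c' \<in> contacts d s B \<Longrightarrow> crd d c = crd d c'"
  by (cases d) (auto simp: contacts_def crd_def)

lemma two_elements:
  assumes "2 \<le> card S"
  shows "\<exists>x\<in>S. \<exists>y\<in>S. x \<noteq> y"
proof (rule ccontr)
  assume neg: "\<not> ?thesis"
  have "S \<noteq> {}" using assms by auto
  then obtain x where "S = {x}" using neg by blast
  then show False using assms by simp
qed

context tree_fractal
begin

text \<open>By \<open>edges_G\<close> there is a single exit from \<open>G\<close>, and parents lead
  from every point of \<open>G\<close> to it without leaving \<open>G\<close>.\<close>

lemma k_eq_1_imp_tree_G:
  assumes "k = 1"
  shows "grid_tree G"
proof -
  obtain r p \<delta> where rt: "rooted_tree T r p \<delta>" and r: "r \<notin> G"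
    using ex_rooted[OF fin_G] by blast
  have "card {u \<in> G. p u \<notin> G} + edges G = card G"
    by (rule rooted_tree_exits[OF rt fin_G G_sub_T r])
  then have "card {u \<in> G. p u \<notin> G} = 1" using edges_G assms by simp
  then obtain z where z: "{u \<in> G. p u \<notin> G} = {z}" using card_1_singletonE by blast
  have to_z: "(u, z) \<in> (edge_rel G)\<^sup>*" if "u \<in> G" for u
    using that
  proof (induction "\<delta> u" arbitrary: u rule: less_induct)
    case less
    show ?case
    proof (cases "u = z")
      case False
      then have pu: "p u \<in> G" using z less.prems by blast
      have uT: "u \<in> T" "u \<noteq> r" using less.prems G_sub_T r by auto
      then have "grid_adj u (p u)" "\<delta> u = Suc (\<delta> (p u))"
        using rt parent_mapD[of T r p \<delta> u] unfolding rooted_tree_def by blast+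
      then have "(u, p u) \<in> edge_rel G" "(p u, z) \<in> (edge_rel G)\<^sup>*"
        using less pu by (simp_all add: edge_rel_def)
      then show ?thesis by (rule converse_rtrancl_into_rtrancl)
    qed simp
  qed
  have "(z, u) \<in> (edge_rel G)\<^sup>*" if "u \<in> G" for u
    using to_z[OF that] sym_rtrancl[OF sym_edge_rel[of G]] by (meson symD)
  then have "grid_connected G"
    unfolding grid_connected_iff using to_z by (meson rtrancl_trans)
  moreover have "grid_acyclic G"
    using tree G_sub_T grid_acyclic_mono by (auto simp: grid_tree_def)
  ultimately show ?thesis by (simp add: grid_tree_def)
qed

text \<open>\<open>A\<close> is the side of \<open>a\<close> after removal of the edge from
  \<open>a\<close> to \<open>b\<close>, expressed by the fact that no other edge leaves
  \<open>A\<close>.\<close>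

definition finite_side :: "pt \<Rightarrow> pt \<Rightarrow> bool" where
  "finite_side a b \<longleftrightarrow> (\<exists>A. finite A \<and> A \<subseteq> T \<and> a \<in> A \<and> b \<in> T \<and> b \<notin> A \<and>
     (\<forall>x\<in>A. \<forall>y\<in>T. y \<notin> A \<longrightarrow> grid_adj x y \<longrightarrow> x = a \<and> y = b))"

definition fin_dir :: "dir \<Rightarrow> bool" where
  "fin_dir d \<longleftrightarrow> (\<exists>a b. nb d a b \<and> finite_side a b)"

text \<open>\<open>F\<close> contains all descendants of its points, so the descendants of
  \<open>u\<close> form the finite side.\<close>

lemma parent_finite_side:
  assumes rt: "rooted_tree T r p \<delta>" and F: "finite F" "F \<subseteq> T" "r \<notin> F" and u: "u \<in> F"
    and closed: "\<And>w. w \<in> T \<Longrightarrow> w \<noteq> r \<Longrightarrow> p w \<in> F \<Longrightarrow> w \<in> F"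
  shows "finite_side u (p u)"
proof -
  have pm: "parent_map T r p \<delta>" using rt by (simp add: rooted_tree_def)
  define R where "R = {(w, p w) |w. w \<in> T \<and> w \<noteq> r}"
  define A where "A = {w. (w, u) \<in> R\<^sup>*}"
  have AF: "w \<in> F \<and> \<delta> u \<le> \<delta> w" if "(w, u) \<in> R\<^sup>*" for w
    using that
  proof (induction rule: converse_rtrancl_induct)
    case base
    then show ?case using u by simp
  next
    case (step y z)
    then have y: "y \<in> T" "y \<noteq> r" "z = p y" by (auto simp: R_def)
    then show ?case using step.IH closed[OF y(1,2)] parent_mapD(3)[OF pm y(1,2)] by simp
  qed
  have uT: "u \<in> T" "u \<noteq> r" using u F by auto
  show ?thesis
    unfolding finite_side_def
  proof (intro exI[of _ A] conjI ballI impI)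
    have "A \<subseteq> F" using AF by (auto simp: A_def)
    then show "finite A" "A \<subseteq> T" using F finite_subset by auto
    show "u \<in> A" by (simp add: A_def)
    show "p u \<in> T" by (rule parent_mapD(1)[OF pm uT])
    show "p u \<notin> A" using AF[of "p u"] parent_mapD(3)[OF pm uT] by (auto simp: A_def)
    fix x y assume xy: "x \<in> A" "y \<in> T" "y \<notin> A" "grid_adj x y"
    have "x \<in> T" using xy(1) \<open>A \<subseteq> T\<close> by blast
    then consider "x \<noteq> r" "y = p x" | "y \<noteq> r" "x = p y"
      using rt xy(2,4) unfolding rooted_tree_def by blast
    then have "x = u \<and> y = p x"
    proof cases
      case 1
      have "(x, u) \<in> R\<^sup>*" using xy(1) by (simp add: A_def)
      then show ?thesis
      proof (cases rule: converse_rtranclE)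
        case base
        then show ?thesis using 1 by simp
      next
        case (step z)
        then have "z = p x" by (auto simp: R_def)
        then show ?thesis using step(2) 1(2) xy(3) by (simp add: A_def)
      qed
    next
      case 2
      then have "(y, x) \<in> R" using xy(2) unfolding R_def by blast
      then have "y \<in> A" using xy(1) unfolding A_def by (simp add: converse_rtrancl_into_rtrancl)
      then show ?thesis using xy(3) by simp
    qed
    then show "x = u" "y = p u" by auto
  qed
qed

section \<open>Flows on the generator\<close>

text \<open>A forest on \<open>G\<close> directed towards the contacts of side \<open>d\<close>: the
  arrows end there because \<open>\<delta>\<close> drops, and by the second clause every edge of
  \<open>G\<close> is an arrow.\<close>

definition is_flow :: "dir \<Rightarrow> (pt \<Rightarrow> pt) \<Rightarrow> (pt \<Rightarrow> nat) \<Rightarrow> bool" where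
  "is_flow d \<pi> \<delta> \<longleftrightarrow>
    (\<forall>c\<in>G. c \<notin> con d \<longrightarrow> \<pi> c \<in> G \<and> (\<exists>e. fin_dir e \<and> nb e c (\<pi> c)) \<and> \<delta> c = Suc (\<delta> (\<pi> c))) \<and>
    (\<forall>a\<in>G. \<forall>b\<in>G. grid_adj a b \<longrightarrow> a \<notin> con d \<and> b = \<pi> a \<or> b \<notin> con d \<and> a = \<pi> b)"

lemma flowD:
  assumes "is_flow d \<pi> \<delta>" "c \<in> G" "c \<notin> con d"
  shows "\<pi> c \<in> G" "\<exists>e. fin_dir e \<and> nb e c (\<pi> c)" "\<delta> c = Suc (\<delta> (\<pi> c))"
  using assms unfolding is_flow_def by blast+

lemma flow_edge:
  assumes "is_flow d \<pi> \<delta>" "a \<in> G" "b \<in> G" "grid_adj a b"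
  shows "a \<notin> con d \<and> b = \<pi> a \<or> b \<notin> con d \<and> a = \<pi> b"
  using assms unfolding is_flow_def by blast

text \<open>With root \<open>b\<close>, only \<open>a\<close> has its parent outside
  \<open>A\<close>, so the number of exits is one.\<close>

lemma edges_finite_side:
  assumes "finite A" "A \<subseteq> T" "a \<in> A" "b \<in> T" "b \<notin> A"
    and only: "\<And>x y. x \<in> A \<Longrightarrow> y \<in> T \<Longrightarrow> y \<notin> A \<Longrightarrow> grid_adj x y \<Longrightarrow> x = a \<and> y = b"
  shows "Suc (edges A) = card A"
proof -
  obtain p \<delta> where rt: "rooted_tree T b p \<delta>" using tree_imp_rooted_tree[OF tree assms(4)] by blast
  have pm: "parent_map T b p \<delta>" using rt by (simp add: rooted_tree_def)
  have inT: "u \<in> T \<and> u \<noteq> b" if "u \<in> A" for u using that assms(2,5) by blast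
  have "{u \<in> A. p u \<notin> A} \<subseteq> {a}"
    using only parent_mapD(1,2)[OF pm] inT by blast
  moreover have "{u \<in> A. p u \<notin> A} \<noteq> {}"
  proof
    assume neg: "{u \<in> A. p u \<notin> A} = {}"
    obtain u where u: "u \<in> A" "\<And>w. w \<in> A \<Longrightarrow> \<delta> u \<le> \<delta> w"
      using ex_has_least_nat[of "\<lambda>u. u \<in> A" a \<delta>] assms(3) by blast
    have "p u \<in> A" using neg u(1) by blast
    then show False using u(2)[of "p u"] parent_mapD(3)[OF pm, of u] inT[OF u(1)] by simp
  qed
  ultimately have "{u \<in> A. p u \<notin> A} = {a}" by blast
  then have "card {u \<in> A. p u \<notin> A} = 1" by simp
  then show ?thesis using rooted_tree_exits[OF rt assms(1,2,5)] by simp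
qed

text \<open>If the side \<open>A\<close> of the edge from \<open>q\<close> to \<open>q'\<close> is finite, exactly \<open>k\<close> points of the blown-up
  set have their parent outside it, so these are the \<open>k\<close> contact points of the block of \<open>q\<close>; the block
  itself also has only \<open>k\<close> such points.  Hence the parent map induces a flow on \<open>G\<close>.\<close>

lemma fin_dir_flow:
  assumes "fin_dir d"
  shows "\<exists>\<pi> \<delta>. is_flow d \<pi> \<delta>"
proof -
  obtain q q' where qq: "nb d q q'" "finite_side q q'" using assms by (auto simp: fin_dir_def)
  obtain A where A: "finite A" "A \<subseteq> T" "q \<in> A" "q' \<in> T" "q' \<notin> A"
    and only: "\<And>x y. x \<in> A \<Longrightarrow> y \<in> T \<Longrightarrow> y \<notin> A \<Longrightarrow> grid_adj x y \<Longrightarrow> x = q \<and> y = q'"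
    using qq(2) unfolding finite_side_def by blast
  define F where "F = blow g G A"
  define B where "B = blow g G {q}"
  define C where "C = blow g (con d) {q}"
  obtain e e' where e: "e \<in> G" "e' \<in> G" "wrap d g e e'"
    using contacts_ne[of d] by (auto simp: contacts_def)
  \<comment> \<open>The root is placed in the block of \<open>q'\<close>, beyond the blown-up side
    \<open>F\<close>.\<close>
  define r where "r = plift g q' e'"
  have rT: "r \<in> T" using A(4) e(2) unfolding r_def by (rule plift_T)
  have rF: "r \<notin> F" using A(5) mem_blow_plift[OF box_G e(2)] by (simp add: r_def F_def)
  have finF: "finite F" and finB: "finite B"
    using finite_blow[OF box_G fin_G] A(1) by (simp_all add: F_def B_def)
  have FT: "F \<subseteq> T" using T_blow_g A(2) by (auto simp: F_def blow_def)
  have BF: "B \<subseteq> F" using A(3) by (auto simp: F_def B_def blow_def)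
  have CB: "C \<subseteq> B" using contacts_subset by (auto simp: B_def C_def blow_def)
  have cardC: "card C = k"
    unfolding C_def by (subst card_blow[OF in_box_mono[OF box_G contacts_subset]]) (simp add: card_con)
  obtain p \<delta> where rt: "rooted_tree T r p \<delta>" using tree_imp_rooted_tree[OF tree rT] by blast
  have pm: "parent_map T r p \<delta>" using rt by (simp add: rooted_tree_def)
  have boundary: "u \<in> C \<and> nb d u b" if u: "u \<in> F" "b \<in> T" "b \<notin> F" "grid_adj u b" for u b
  proof -
    obtain f where f: "nb f u b" using u(4) by (auto simp: grid_adj_iff_nb)
    have "b \<in> blow g G T" using u(2) T_blow_g by simp
    note bb = blow_boundary[OF g0 u(1)[unfolded F_def] this u(3)[unfolded F_def] f]
    have "grid_adj (pdiv g u) (pdiv g b)" using bb(1) by (auto simp: grid_adj_iff_nb)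
    then have eq: "pdiv g u = q" "pdiv g b = q'" using only[OF bb(4,2,3)] by auto
    then have "f = d" using bb(1) qq(1) nb_unique_dir by blast
    then show ?thesis using bb(5) eq(1) f by (simp add: C_def blow_def)
  qed
  have uT: "u \<in> T" "u \<noteq> r" if "u \<in> F" for u using that FT rF by auto
  have padj: "p u \<in> T" "grid_adj u (p u)" if "u \<in> F" for u
    using parent_mapD[OF pm uT[OF that]] by auto
  define XF where "XF = {u \<in> F. p u \<notin> F}"
  have "XF \<subseteq> C"
  proof
    fix u assume "u \<in> XF"
    then have u: "u \<in> F" "p u \<notin> F" by (auto simp: XF_def)
    show "u \<in> C" using boundary[OF u(1) padj(1)[OF u(1)] u(2) padj(2)[OF u(1)]] by simp
  qed
  \<comment> \<open>Points minus edges of \<open>F\<close> is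
    \<open>card A * k - k * (card A - 1)\<close>.\<close>
  moreover have "card XF = k"
  proof -
    have "card XF + edges F = card F"
      unfolding XF_def by (rule rooted_tree_exits[OF rt finF FT rF])
    moreover have "edges F = card A * edges G + k * edges A"
      unfolding F_def edges_blow[OF box_G g0 fin_G A(1)]
      by (simp add: card_con edges_def algebra_simps)
    moreover have "card F = card A * (edges G + k)"
      unfolding F_def card_blow[OF box_G] edges_G ..
    moreover have "card A = Suc (edges A)"
      using edges_finite_side[OF A only] by simp
    ultimately show ?thesis by (simp add: algebra_simps)
  qed
  moreover have finC: "finite C" using CB finB by (rule finite_subset)
  ultimately have XC: "XF = C" using cardC by (metis card_subset_eq)
  define XB where "XB = {u \<in> B. p u \<notin> B}"
  have "C \<subseteq> XB" using XC CB BF by (auto simp: XF_def XB_def)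
  moreover have "card XB = k"
  proof -
    have "card XB + edges B = card B"
      unfolding XB_def using rooted_tree_exits[OF rt finB] BF FT rF by blast
    moreover have "edge_starts f {q} = {}" for f by (auto simp: edge_starts_def dest: nb_neq)
    then have "edges B = edges G"
      unfolding B_def by (simp add: edges_blow[OF box_G g0 fin_G])
    moreover have "card B = card G" unfolding B_def by (simp add: card_blow[OF box_G])
    ultimately show ?thesis using edges_G by simp
  qed
  moreover have "finite XB" using finB by (simp add: XB_def)
  \<comment> \<open>The contacts in \<open>C\<close> already account for all \<open>k\<close> exits
    of the block, so every other parent stays inside it.\<close>
  ultimately have BC: "XB = C" using cardC by (metis card_subset_eq)
  \<comment> \<open>A child outside \<open>F\<close> would lie across a contact whose own parent is
    that same neighbour, a cycle of length two.\<close>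
  have closed: "w \<in> F" if w: "w \<in> T" "w \<noteq> r" "p w \<in> F" for w
  proof (rule ccontr)
    assume "w \<notin> F"
    have "grid_adj (p w) w" using parent_mapD(2)[OF pm w(1,2)] by (simp add: grid_adj_sym)
    then have pw: "p w \<in> C" "nb d (p w) w" using boundary[OF w(3,1) \<open>w \<notin> F\<close>] by auto
    then have "p (p w) \<notin> F" using XC by (auto simp: XF_def)
    then have "nb d (p w) (p (p w))" using boundary[OF w(3)] padj[OF w(3)] by blast
    then have "p (p w) = w" using pw(2) nb_unique by blast
    then show False using parent_map_no_2cycle[OF pm w(1,2)] uT(2)[OF w(3)] by blast
  qed
  have fside: "finite_side u (p u)" if "u \<in> F" for u
    by (rule parent_finite_side[OF rt finF FT rF that closed])
  define \<pi> where "\<pi> c = pmod g (p (plift g q c))" for c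
  have inB: "plift g q c \<in> B" if "c \<in> G" for c
    using mem_blow_plift[OF box_G that] by (simp add: B_def)
  have inC: "plift g q c \<in> C \<longleftrightarrow> c \<in> con d" if "c \<in> G" for c
    using that by (simp add: C_def blow_def pdiv_plift[OF that box_G] pmod_plift[OF that box_G])
  have B_plift: "plift g q (pmod g w) = w \<and> pmod g w \<in> G" if "w \<in> B" for w
    using that plift_pdiv_pmod[of g w] by (auto simp: B_def blow_def)
  have flow1: "\<pi> c \<in> G \<and> p (plift g q c) = plift g q (\<pi> c)" if c: "c \<in> G" "c \<notin> con d" for c
  proof -
    have "plift g q c \<notin> XB" using inC[OF c(1)] c(2) BC by simp
    then have "p (plift g q c) \<in> B" using inB[OF c(1)] by (simp add: XB_def)
    then show ?thesis using B_plift by (simp add: \<pi>_def)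
  qed
  have "is_flow d \<pi> (\<lambda>c. \<delta> (plift g q c))"
    unfolding is_flow_def
  proof (intro conjI ballI impI)
    fix c assume c: "c \<in> G" "c \<notin> con d"
    have cF: "plift g q c \<in> F" using inB[OF c(1)] BF by blast
    show "\<pi> c \<in> G" using flow1[OF c] by simp
    show "\<delta> (plift g q c) = Suc (\<delta> (plift g q (\<pi> c)))"
      using parent_mapD(3)[OF pm uT[OF cF]] flow1[OF c] by simp
    obtain f where f: "nb f (plift g q c) (p (plift g q c))"
      using padj(2)[OF cF] by (auto simp: grid_adj_iff_nb)
    then have "fin_dir f" using fside[OF cF] unfolding fin_dir_def by blast
    moreover have "nb f c (\<pi> c)"
      using f flow1[OF c] c(1) nb_pdiv_pmod[OF g0, of f "plift g q c" "plift g q (\<pi> c)"] nb_neq[of f q q]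
      by (auto simp: pdiv_plift[OF _ box_G] pmod_plift[OF _ box_G])
    ultimately show "\<exists>f. fin_dir f \<and> nb f c (\<pi> c)" by blast
  next
    fix a b assume ab: "a \<in> G" "b \<in> G" "grid_adj a b"
    have adj: "grid_adj (plift g q a) (plift g q b)"
      using ab(3) nb_plift unfolding grid_adj_iff_nb by metis
    have arrow: "c \<notin> con d \<and> c' = \<pi> c" if c: "c \<in> G" "c' \<in> G" "plift g q c' = p (plift g q c)" for c c'
    proof -
      have "plift g q c \<notin> XB" using inB[OF c(2)] c(3) by (simp add: XB_def)
      then have "c \<notin> con d" using inC[OF c(1)] BC by simp
      moreover have "c' = \<pi> c" using c(3) pmod_plift[OF c(2) box_G] unfolding \<pi>_def by metis
      ultimately show ?thesis by simp
    qed
    have "plift g q a \<in> T" "plift g q b \<in> T" using inB ab BF FT by blast+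
    then have "plift g q b = p (plift g q a) \<or> plift g q a = p (plift g q b)"
      using rt adj unfolding rooted_tree_def by blast
    then show "a \<notin> con d \<and> b = \<pi> a \<or> b \<notin> con d \<and> a = \<pi> b"
      using arrow ab(1,2) by blast
  qed
  then show ?thesis by blast
qed

text \<open>The end of the flow line from \<open>c\<close>. Contacts are kept fixed, so
  \<open>\<delta> c\<close> iterations are enough.\<close>

definition sink :: "dir \<Rightarrow> (pt \<Rightarrow> pt) \<Rightarrow> (pt \<Rightarrow> nat) \<Rightarrow> pt \<Rightarrow> pt" where
  "sink d \<pi> \<delta> c = ((\<lambda>c. if c \<in> con d then c else \<pi> c) ^^ \<delta> c) c"

lemma sink_con: "c \<in> con d \<Longrightarrow> sink d \<pi> \<delta> c = c"
proof -
  assume c: "c \<in> con d"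
  have "((\<lambda>c. if c \<in> con d then c else \<pi> c) ^^ n) c = c" for n
    using c by (induction n) simp_all
  then show ?thesis by (simp add: sink_def)
qed

lemma sink_step:
  assumes "is_flow d \<pi> \<delta>" "c \<in> G" "c \<notin> con d"
  shows "sink d \<pi> \<delta> (\<pi> c) = sink d \<pi> \<delta> c"
  unfolding sink_def flowD(3)[OF assms] funpow_Suc_right using assms(3) by simp

lemma sink_edge:
  assumes "is_flow d \<pi> \<delta>" "a \<in> G" "b \<in> G" "grid_adj a b"
  shows "sink d \<pi> \<delta> a = sink d \<pi> \<delta> b"
  using flow_edge[OF assms] sink_step[OF assms(1)] assms(2,3) by metis

text \<open>Following the flow towards side \<open>e\<close> from a contact point on side \<open>d\<close>, every edge is traversed
  against the flow towards side \<open>d\<close>.  If only one orientation is available on the axis of \<open>d\<close>, no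
  edge on that axis occurs.\<close>

lemma flow_to_corner:
  assumes fd: "is_flow d \<pi> \<delta>" and fe: "is_flow e \<pi>' \<delta>'" and z: "horiz z = horiz d" "\<not> fin_dir z"
    and c: "c \<in> G" and inv: "c \<in> con d \<or> c \<notin> con d \<and> \<pi> c \<notin> con e \<and> \<pi>' (\<pi> c) = c"
  shows "\<exists>y\<in>con e. crd d y = crd d c \<and> sink d \<pi> \<delta> y = sink d \<pi> \<delta> c"
  using c inv
proof (induction "\<delta>' c" arbitrary: c rule: less_induct)
  case less
  note c = less(2)
  show ?case
  proof (cases "c \<in> con e")
    case True
    then show ?thesis by blast
  next
    case False
    define c' where "c' = \<pi>' c"
    note fl = flowD[OF fe c False, folded c'_def]
    obtain f where f: "fin_dir f" "nb f c c'" using fl(2) by blast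
    have adj: "grid_adj c c'" using f(2) by (auto simp: grid_adj_iff_nb)
    \<comment> \<open>Otherwise the invariant gives \<open>\<pi>' c' = c\<close>, but arrows back
      and forth cannot both lower \<open>\<delta>'\<close>.\<close>
    have "\<not> (c \<notin> con d \<and> c' = \<pi> c)"
    proof
      assume *: "c \<notin> con d \<and> c' = \<pi> c"
      then have "c' \<notin> con e" "\<pi>' c' = c" using less(3) by auto
      then have "\<delta>' c' = Suc (\<delta>' c)" using flowD(3)[OF fe fl(1)] by simp
      then show False using fl(3) by simp
    qed
    then have bk: "c' \<notin> con d" "c = \<pi> c'" using flow_edge[OF fd c fl(1) adj] by auto
    obtain f' where f': "fin_dir f'" "nb f' c' c" using flowD(2)[OF fd fl(1) bk(1)] bk(2) by auto
    then have "nb (opp f') c c'" by (simp add: nb_opp)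
    then have ff: "f = opp f'" using f(2) nb_unique_dir by blast
    \<comment> \<open>The two flows use the edge in opposite directions; on the axis of
      \<open>d\<close> this would make both orientations, hence \<open>z\<close>, available.\<close>
    have "horiz f \<noteq> horiz d"
    proof
      assume "horiz f = horiz d"
      then have "z = f \<or> z = opp f" using z(1) same_axis[of z f] by simp
      then show False using z(2) f(1) f'(1) ff by auto
    qed
    then have crd: "crd d c = crd d c'" by (rule nb_crd[OF f(2)])
    have snk: "sink d \<pi> \<delta> c = sink d \<pi> \<delta> c'" by (rule sink_edge[OF fd c fl(1) adj])
    have "\<exists>y\<in>con e. crd d y = crd d c' \<and> sink d \<pi> \<delta> y = sink d \<pi> \<delta> c'"
    proof (rule less(1))
      show "\<delta>' c' < \<delta>' c" using fl(3) by simp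
      show "c' \<in> G" by (rule fl(1))
      show "c' \<in> con d \<or> c' \<notin> con d \<and> \<pi> c' \<notin> con e \<and> \<pi>' (\<pi> c') = c'"
        using bk False by (simp add: c'_def[symmetric] bk(2)[symmetric])
    qed
    then show ?thesis using crd snk by simp
  qed
qed

text \<open>Without \<open>z\<close>, \<open>flow_to_corner\<close> assigns to each contact on side
  \<open>d\<close> a point of side \<open>e\<close> in the same corner. Two contacts share that
  point, although its sink is unique.\<close>

lemma fin_dir_both_orientations:
  assumes k2: "2 \<le> k" and de: "fin_dir d" "fin_dir e" "horiz d \<noteq> horiz e" and z: "horiz z = horiz d"
  shows "fin_dir z"
proof (rule ccontr)
  assume nz: "\<not> fin_dir z"
  obtain \<pi> \<delta> where fd: "is_flow d \<pi> \<delta>" using fin_dir_flow[OF de(1)] by blast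
  obtain \<pi>' \<delta>' where fe: "is_flow e \<pi>' \<delta>'" using fin_dir_flow[OF de(2)] by blast
  have corner: "\<exists>y\<in>con e. crd d y = crd d x \<and> sink d \<pi> \<delta> y = x" if x: "x \<in> con d" for x
    using flow_to_corner[OF fd fe z nz subsetD[OF contacts_subset x]] x sink_con[OF x] by metis
  obtain x1 x2 where x: "x1 \<in> con d" "x2 \<in> con d" "x1 \<noteq> x2"
    using two_elements[of "con d"] k2 card_con by auto
  obtain y1 where y1: "y1 \<in> con e" "crd d y1 = crd d x1" "sink d \<pi> \<delta> y1 = x1"
    using corner[OF x(1)] by blast
  obtain y2 where y2: "y2 \<in> con e" "crd d y2 = crd d x2" "sink d \<pi> \<delta> y2 = x2"
    using corner[OF x(2)] by blast
  have "y1 = y2"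
    using crd_eqI[of d y1 y2 e] y1(2) y2(2) contacts_same_side[OF x(1,2)]
      contacts_same_side[OF y1(1) y2(1)] de(3) by simp
  then show False using y1(3) y2(3) x(3) by simp
qed

text \<open>\<open>G\<close> has an edge on each axis, and every edge of \<open>G\<close> is an
  arrow of the flow.\<close>

lemma fin_dir_axis:
  assumes "fin_dir d" "forward f"
  shows "\<exists>e. horiz e = horiz f \<and> fin_dir e"
proof -
  obtain \<pi> \<delta> where fl: "is_flow d \<pi> \<delta>" using fin_dir_flow[OF assms(1)] by blast
  obtain a b where ab: "a \<in> G" "b \<in> G" "nb f a b"
    using edge_starts_ne[of f] assms(2) by (auto simp: forward_def edge_starts_def)
  then have "grid_adj a b" by (auto simp: grid_adj_iff_nb)
  then consider "a \<notin> con d" "b = \<pi> a" | "b \<notin> con d" "a = \<pi> b"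
    using flow_edge[OF fl ab(1,2)] by blast
  then show ?thesis
  proof cases
    case 1
    then obtain e where e: "fin_dir e" "nb e a b" using flowD(2)[OF fl ab(1)] by auto
    then have "e = f" using nb_unique_dir ab(3) by blast
    then show ?thesis using e(1) by blast
  next
    case 2
    then obtain e where e: "fin_dir e" "nb e b a" using flowD(2)[OF fl ab(2)] by auto
    have "nb (opp f) b a" using ab(3) by (simp add: nb_opp)
    then have "e = opp f" using nb_unique_dir e(2) by blast
    then show ?thesis using e(1) by (intro exI[of _ "opp f"]) simp
  qed
qed

lemma fin_dir_all:
  assumes "2 \<le> k" "fin_dir d"
  shows "fin_dir z"
proof -
  obtain e where e: "horiz e" "fin_dir e" using fin_dir_axis[OF assms(2), of East] by (auto simp: forward_def)
  obtain f where f: "\<not> horiz f" "fin_dir f" using fin_dir_axis[OF assms(2), of North] by (auto simp: forward_def)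
  show ?thesis
  proof (cases "horiz z")
    case True
    then show ?thesis using fin_dir_both_orientations[OF assms(1) e(2) f(2)] e(1) f(1) by simp
  next
    case False
    then show ?thesis using fin_dir_both_orientations[OF assms(1) f(2) e(2)] e(1) f(1) by simp
  qed
qed

text \<open>The sinks identify the component of a point in its block with a contact on any prescribed side.
  Pushing a point through the blocks down to the block of the origin then gives a labelling of \<open>T\<close>
  that is constant along edges but separates the contacts of the origin block.\<close>

lemma not_all_fin_dir:
  assumes k2: "2 \<le> k" and all: "\<And>d. fin_dir d"
  shows False
proof -
  have "\<forall>d. \<exists>\<pi> \<delta>. is_flow d \<pi> \<delta>" using fin_dir_flow[OF all] by blast
  then obtain \<pi> \<epsilon> where fl: "\<And>d. is_flow d (\<pi> d) (\<epsilon> d)" by metis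
  define s where "s d = sink d (\<pi> d) (\<epsilon> d)" for d
  have s: "\<And>d c. c \<in> con d \<Longrightarrow> s d c = c"
      "\<And>d a b. a \<in> G \<Longrightarrow> b \<in> G \<Longrightarrow> grid_adj a b \<Longrightarrow> s d a = s d b"
    unfolding s_def by (rule sink_con, assumption) (rule sink_edge[OF fl])
  obtain p \<delta> where rt: "rooted_tree T (0, 0) p \<delta>" using tree_imp_rooted_tree[OF tree zero_T] by blast
  have pm: "parent_map T (0, 0) p \<delta>" using rt by (simp add: rooted_tree_def)
  define dir_of where "dir_of q = (THE d. nb d q (p q))" for q
  \<comment> \<open>\<open>up\<close> passes from \<open>u\<close> to its sink on the side facing
    the parent block and crosses into that block.\<close>
  define up where "up u = (SOME w. nb (dir_of (pdiv g u))
      (plift g (pdiv g u) (s (dir_of (pdiv g u)) (pmod g u))) w)" for u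
  define lab where "lab n u = s East (pmod g ((up ^^ n) u))" for n u
  define label where "label u = lab (\<delta> (pdiv g u)) u" for u
  have same_block: "label u = label w" if u: "pdiv g u = pdiv g w" "grid_adj (pmod g u) (pmod g w)"
      "u \<in> T" "w \<in> T" for u w
  proof -
    have eq: "s d (pmod g u) = s d (pmod g w)" for d
      using s(2)[OF _ _ u(2)] u(3,4) mem_T_iff by blast
    then have "up u = up w" by (simp add: up_def u(1))
    then have "(up ^^ n) u = (up ^^ n) w" if "n > 0" for n
      using that by (cases n) (simp_all add: funpow_swap1 del: funpow.simps add: funpow_Suc_right)
    then show ?thesis using eq by (cases "\<delta> (pdiv g w) = 0") (simp_all add: label_def lab_def u(1))
  qed
  \<comment> \<open>Here \<open>u\<close> is itself the contact facing \<open>w\<close>, so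
    \<open>up u = w\<close> while the depth of the block falls by one.\<close>
  have up_block: "label u = label w"
    if u: "nb d u w" "u \<in> T" "w \<in> T" "pdiv g u \<noteq> (0, 0)" "pdiv g w = p (pdiv g u)" "pdiv g u \<noteq> pdiv g w"
    for u w d
  proof -
    have uT: "pdiv g u \<in> T" using u(2) mem_T_iff by blast
    have nbw: "nb d (pdiv g u) (pdiv g w)" "wrap d g (pmod g u) (pmod g w)"
      using nb_imp_wrap[OF u(1) g0 u(6)] by auto
    then have dir: "dir_of (pdiv g u) = d"
      unfolding dir_of_def u(5)[symmetric]
      using nbw(1) by (blast intro: the_equality nb_unique_dir)
    have "pmod g u \<in> con d" using nbw(2) u(2,3) mem_T_iff unfolding contacts_def by blast
    then have "up u = (SOME w. nb d u w)" by (simp add: up_def dir s(1))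
    also have "\<dots> = w" using u(1) nb_unique by blast
    finally have "up u = w" .
    moreover have "\<delta> (pdiv g u) = Suc (\<delta> (pdiv g w))"
      using parent_mapD(3)[OF pm uT u(4)] u(5) by simp
    ultimately show ?thesis by (simp add: label_def lab_def funpow_swap1)
  qed
  have edge: "label u = label w" if uw: "(u, w) \<in> edge_rel T" for u w
  proof -
    obtain d where d: "nb d u w" "u \<in> T" "w \<in> T" using edge_imp_nb[OF uw] by blast
    show ?thesis
    proof (cases "pdiv g u = pdiv g w")
      case True
      then have "nb d (pmod g u) (pmod g w)"
        using nb_pdiv_pmod[OF g0, of d u w] d(1) nb_neq by metis
      then have "grid_adj (pmod g u) (pmod g w)" by (auto simp: grid_adj_iff_nb)
      then show ?thesis using same_block True d by blast
    next
      case False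
      then have "nb d (pdiv g u) (pdiv g w)" using nb_imp_wrap[OF d(1) g0] by blast
      then have "grid_adj (pdiv g u) (pdiv g w)" by (auto simp: grid_adj_iff_nb)
      moreover have "pdiv g u \<in> T" "pdiv g w \<in> T" using d mem_T_iff by blast+
      ultimately consider "pdiv g u \<noteq> (0, 0)" "pdiv g w = p (pdiv g u)"
        | "pdiv g w \<noteq> (0, 0)" "pdiv g u = p (pdiv g w)"
        using rt unfolding rooted_tree_def by blast
      then show ?thesis
      proof cases
        case 1
        then show ?thesis using up_block[OF d] False by blast
      next
        case 2
        have "nb (opp d) w u" using d(1) by (simp add: nb_opp)
        then show ?thesis using up_block[OF _ d(3,2) 2] False by metis
      qed
    qed
  qed
  have const: "label u = label (0, 0)" if "u \<in> T" for u
  proof -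
    have "((0, 0), u) \<in> (edge_rel T)\<^sup>*"
      using tree zero_T that by (auto simp: grid_tree_def grid_connected_iff)
    then show ?thesis by (induction rule: rtrancl_induct) (use edge in auto)
  qed
  have "label x = x" if x: "x \<in> con East" for x
  proof -
    have xG: "x \<in> G" using x contacts_subset by blast
    have "pdiv g x = (0, 0)" "pmod g x = x"
      using G_less[OF xG] by (simp_all add: pdiv_def pmod_def)
    then show ?thesis using s(1)[OF x] pm by (simp add: label_def lab_def parent_map_def)
  qed
  moreover obtain x y where "x \<in> con East" "y \<in> con East" "x \<noteq> y"
    using two_elements[of "con East"] k2 card_con by auto
  ultimately show False using const G_sub_T contacts_subset[of East g G] by (metis subsetD)
qed

section \<open>Counting degrees\<close>

definition nbs :: "pt \<Rightarrow> pt set" where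
  "nbs u = {w \<in> T. grid_adj u w}"

lemma finite_nbs: "finite (nbs u)"
  unfolding nbs_def using finite_subset[OF _ finite_grid_adj[of u]] by auto

lemma nb_nbs: "w \<in> nbs u \<longleftrightarrow> w \<in> T \<and> (\<exists>d. nb d u w)"
  by (simp add: nbs_def grid_adj_iff_nb)

text \<open>Inner edges contribute \<open>2 * (card G ^ n - k ^ n)\<close> to the degree sum. Edges
  leaving \<open>X n\<close> go east or north, at most \<open>k ^ n\<close> each way.\<close>

lemma sum_card_nbs_le: "(\<Sum>u\<in>X n. card (nbs u)) \<le> 2 * card (X n)"
proof -
  let ?s = "g ^ n"
  define P where "P d = {(u, w). u \<in> contacts d ?s (X n) \<and> nb d u w}" for d
  have inj: "inj_on fst (P d)" for d
    by (auto intro!: inj_onI simp: P_def dest: nb_unique)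
  have img: "fst ` P d \<subseteq> contacts d ?s (X n)" for d by (auto simp: P_def)
  have finc: "finite (contacts d ?s (X n))" for d
    using finite_subset[OF contacts_subset fin_X] .
  have finP: "finite (P d)" for d
    using finite_imageD[OF finite_subset[OF img finc] inj] .
  have cardP: "card (P d) \<le> k ^ n" for d
    using card_mono[OF finc img, of d] card_image[OF inj, of d] by (simp add: card_contacts_X card_con)
  have "(SIGMA u:X n. nbs u) \<subseteq> edge_rel (X n) \<union> (P East \<union> P North)"
  proof
    fix x assume "x \<in> (SIGMA u:X n. nbs u)"
    then obtain u w where x: "x = (u, w)" "u \<in> X n" "w \<in> T" "grid_adj u w" by (auto simp: nbs_def)
    show "x \<in> edge_rel (X n) \<union> (P East \<union> P North)"
    proof (cases "w \<in> X n")
      case True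
      then show ?thesis using x by (simp add: edge_rel_def)
    next
      case False
      obtain d where d: "nb d u w" using x(4) by (auto simp: grid_adj_iff_nb)
      have "u \<in> blow ?s (X n) {(0, 0)}" "w \<in> blow ?s (X n) T" "w \<notin> blow ?s (X n) {(0, 0)}"
        using x False T_blow X_blow_self[of n] by auto
      note b = blow_boundary[OF gn0 this d]
      have zero: "pdiv ?s u = (0, 0)" using b(4) by simp
      then have "d = East \<or> d = North" using b(1) by (cases d) auto
      moreover have "pmod ?s u = u"
        using zero X_blow_self[of n] plift_pdiv_pmod[of ?s u] by (simp add: plift_def)
      ultimately show ?thesis using b(5) d x(1) by (auto simp: P_def)
    qed
  qed
  then have "card (SIGMA u:X n. nbs u) \<le> card (edge_rel (X n) \<union> (P East \<union> P North))"
    by (rule card_mono[rotated]) (simp add: finite_edge_rel fin_X finP)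
  also have "\<dots> \<le> card (edge_rel (X n)) + (card (P East) + card (P North))"
    by (meson add_le_cancel_left card_Un_le le_trans)
  also have "\<dots> \<le> 2 * edges (X n) + (k ^ n + k ^ n)"
    unfolding card_edge_rel[OF fin_X] by (intro add_mono cardP) simp
  also have "\<dots> = 2 * card (X n)" using edges_X[of n] by (simp add: card_X)
  finally show ?thesis by (simp add: fin_X finite_nbs)
qed

text \<open>For a root elsewhere, the parent is one neighbour; if it were the only one,
  \<open>{u}\<close> would be a finite side.\<close>

lemma card_nbs_ge2:
  assumes none: "\<And>d. \<not> fin_dir d" and u: "u \<in> T"
  shows "2 \<le> card (nbs u)"
proof -
  obtain r p \<delta> where rt: "rooted_tree T r p \<delta>" and r: "r \<noteq> u"
    using ex_rooted[of "{u}"] by auto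
  have "p u \<in> T" "grid_adj u (p u)"
    using exit_nb[OF rt u] r by (auto simp: grid_adj_iff_nb)
  then have pu: "p u \<in> nbs u" by (simp add: nbs_def)
  show ?thesis
  proof (rule ccontr)
    assume "\<not> 2 \<le> card (nbs u)"
    moreover have "card (nbs u) \<noteq> 0" using pu finite_nbs[of u] by auto
    ultimately have "card (nbs u) = 1" by simp
    then obtain w where w: "nbs u = {w}" using card_1_singletonE by blast
    then have wT: "w \<in> T" "grid_adj u w" unfolding nbs_def by blast+
    have only: "y = w" if "y \<in> T" "grid_adj u y" for y using w that unfolding nbs_def by blast
    have "w \<noteq> u" using wT(2) by auto
    have "finite_side u w"
      unfolding finite_side_def
    proof (intro exI[of _ "{u}"] conjI ballI impI)
      show "w \<notin> {u}" using \<open>w \<noteq> u\<close> by simp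
      fix x y assume "x \<in> {u}" "y \<in> T" "grid_adj x y"
      then show "x = u" "y = w" using only by simp_all
    qed (simp_all add: u wT)
    moreover obtain d where "nb d u w" using wT(2) by (auto simp: grid_adj_iff_nb)
    ultimately show False using none[of d] unfolding fin_dir_def by blast
  qed
qed

text \<open>The average degree over each level is at most two, while no degree is below two.\<close>

lemma card_nbs_eq_2:
  assumes none: "\<And>d. \<not> fin_dir d" and u: "u \<in> T"
  shows "card (nbs u) = 2"
proof (rule ccontr)
  assume "card (nbs u) \<noteq> 2"
  then have gt: "2 < card (nbs u)" using card_nbs_ge2[OF none u] by simp
  obtain n where n: "u \<in> X n" using u by (auto simp: T_eq)
  have "(\<Sum>u\<in>X n. 2) < (\<Sum>u\<in>X n. card (nbs u))"
    by (rule sum_strict_mono_ex1[OF fin_X]) (use card_nbs_ge2[OF none] X_sub_T n gt in auto)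
  then show False using sum_card_nbs_le[of n] by simp
qed

text \<open>Otherwise all degrees are two. A suitable East contact then has two neighbours inside
  its block, and a third as soon as the eastern block is present.\<close>

lemma ex_fin_dir:
  assumes k2: "2 \<le> k"
  shows "\<exists>d. fin_dir d"
proof (rule ccontr)
  assume "\<not> ?thesis"
  then have none: "\<And>d. \<not> fin_dir d" by blast
  have two: "card (nbs u) = 2" if "u \<in> T" for u by (rule card_nbs_eq_2[OF none that])
  have three: False if "u \<in> T" "a \<in> nbs u" "b \<in> nbs u" "c \<in> nbs u" "a \<noteq> b" "a \<noteq> c" "b \<noteq> c" for u a b c
  proof -
    have "{a, b, c} \<subseteq> nbs u" using that(2-4) by simp
    then have "card {a, b, c} \<le> card (nbs u)" by (rule card_mono[OF finite_nbs])
    moreover have "card {a, b, c} = 3" using that(5-7) by simp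
    ultimately show False unfolding two[OF that(1)] by simp
  qed
  have sub: "nbs (0, 0) \<subseteq> {(1, 0), (0, 1)}"
  proof
    fix w assume "w \<in> nbs (0, 0)"
    then show "w \<in> {(1, 0), (0, 1)}" by (cases w) (auto simp: nbs_def grid_adj_def)
  qed
  have "card (nbs (0, 0)) = card {(1::nat, 0::nat), (0, 1)}" using two[OF zero_T] by simp
  then have "nbs (0, 0) = {(1, 0), (0, 1)}" by (intro card_subset_eq[OF _ sub]) simp_all
  then have "(1, 0) \<in> T" "(0, 1) \<in> T" by (auto simp: nbs_def)
  moreover have "pmod g (1, 0) = (1, 0)" "pmod g (0, 1) = (0, 1)" using g by (simp_all add: pmod_def)
  ultimately have G10: "(1, 0) \<in> G" and G01: "(0, 1) \<in> G" by (metis mem_T_iff)+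
  \<comment> \<open>Otherwise \<open>(g, 0)\<close> would have three neighbours.\<close>
  have corner: "(g - 1, 0) \<notin> G"
  proof
    assume c: "(g - 1, 0) \<in> G"
    have T: "(g - 1, 0) \<in> T" "(g, 0) \<in> T" "(g + 1, 0) \<in> T" "(g, 1) \<in> T"
      using c G_sub_T plift_T[OF \<open>(1, 0) \<in> T\<close> zero_G] plift_T[OF \<open>(1, 0) \<in> T\<close> G10]
        plift_T[OF \<open>(1, 0) \<in> T\<close> G01] by (auto simp: plift_def)
    show False
      by (rule three[OF T(2), of "(g - 1, 0)" "(g + 1, 0)" "(g, 1)"])
        (use T g in \<open>auto simp: nbs_def grid_adj_def\<close>)
  qed
  \<comment> \<open>One of two contacts avoids the northern corner, and \<open>corner\<close>
    excludes the southern one; such a contact leads out of its block only to the east.\<close>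
  obtain y where y: "(g - 1, y) \<in> G" "(0, y) \<in> G" "y \<noteq> g - 1"
  proof -
    obtain a b where ab: "a \<in> con East" "b \<in> con East" "a \<noteq> b"
      using two_elements[of "con East"] k2 card_con by auto
    then show ?thesis using that unfolding con_East by (cases "snd a = g - 1") auto
  qed
  have y0: "y \<noteq> 0" using y(1) corner by metis
  have yg: "y < g" using G_less[OF y(1)] by simp
  define c where "c = (g - 1, y)"
  define inner where "inner = {b \<in> G. grid_adj c b}"
  have cG: "c \<in> G" using y by (simp add: c_def)
  have inj: "inj_on (plift g q) S" for q S
    using g0 by (auto intro!: inj_onI simp: plift_def prod_eq_iff)
  have inner_nbs: "plift g q ` inner \<subseteq> nbs (plift g q c)" if "q \<in> T" for q
  proof
    fix w assume "w \<in> plift g q ` inner"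
    then obtain b d where b: "b \<in> G" "nb d c b" "w = plift g q b"
      by (auto simp: inner_def grid_adj_iff_nb)
    have "nb d (plift g q c) w" unfolding b(3) by (rule nb_plift[OF b(2)])
    moreover have "w \<in> T" unfolding b(3) by (rule plift_T[OF that b(1)])
    ultimately show "w \<in> nbs (plift g q c)" by (auto simp: nb_nbs)
  qed
  \<comment> \<open>In a block without eastern neighbour all neighbours of \<open>c\<close> are
    inner, so \<open>inner\<close> has two points.\<close>
  obtain i j where ij: "mk East i j \<in> T" "mk East (Suc i) j \<notin> T"
    using ex_last[of East] by (auto simp: forward_def)
  have "nbs (plift g (i, j) c) \<subseteq> plift g (i, j) ` inner"
  proof
    fix w assume "w \<in> nbs (plift g (i, j) c)"
    then obtain d where w: "w \<in> T" "nb d (plift g (i, j) c) w" by (auto simp: nb_nbs)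
    have wT: "pdiv g w \<in> T" "pmod g w \<in> G" using w(1) mem_T_iff by blast+
    have "(pdiv g w = (i, j) \<and> nb d c (pmod g w)) \<or> (nb d (i, j) (pdiv g w) \<and> wrap d g c (pmod g w))"
      using w(2) nb_pdiv_pmod[OF g0, of d "plift g (i, j) c" w]
      by (auto simp: pdiv_plift[OF cG box_G] pmod_plift[OF cG box_G])
    then show "w \<in> plift g (i, j) ` inner"
    proof
      assume *: "pdiv g w = (i, j) \<and> nb d c (pmod g w)"
      then have "w = plift g (i, j) (pmod g w)" using plift_pdiv_pmod[of g w] by simp
      moreover have "pmod g w \<in> inner" using * wT(2) by (auto simp: inner_def grid_adj_iff_nb)
      ultimately show ?thesis by blast
    next
      assume *: "nb d (i, j) (pdiv g w) \<and> wrap d g c (pmod g w)"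
      then have "d = East" using y(3) y0 g by (cases d) (auto simp: c_def)
      then have "pdiv g w = (Suc i, j)" using * by (cases "pdiv g w") auto
      then show ?thesis using wT(1) ij(2) by (simp add: mk_def)
    qed
  qed
  then have "nbs (plift g (i, j) c) = plift g (i, j) ` inner"
    using inner_nbs[of "(i, j)"] ij(1) by (auto simp: mk_def)
  moreover have "plift g (i, j) c \<in> T" using plift_T[OF _ cG] ij(1) by (simp add: mk_def)
  ultimately have card_inner: "card inner = 2" using two by (metis card_image inj)
  \<comment> \<open>A block with an eastern neighbour gives \<open>c\<close> a third
    neighbour.\<close>
  obtain a b where ab: "a \<in> T" "b \<in> T" "nb East a b" using ex_crossing[of East 1] g by auto
  define w where "w = plift g b (0, y)"
  have "wrap East g c (0, y)" by (simp add: c_def)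
  then have "nb East (plift g a c) w"
    unfolding w_def by (rule nb_plift_wrap[OF g0 box_G cG y(2) ab(3)])
  moreover have "w \<in> T" unfolding w_def by (rule plift_T[OF ab(2) y(2)])
  ultimately have wn: "w \<in> nbs (plift g a c)" unfolding nb_nbs by blast
  have "w \<notin> plift g a ` inner"
  proof
    assume "w \<in> plift g a ` inner"
    then obtain e where "e \<in> G" "plift g b (0, y) = plift g a e" by (auto simp: w_def inner_def)
    then have "a = b" using pdiv_plift[OF y(2) box_G, of b] pdiv_plift[OF _ box_G, of e a] by metis
    then show False using ab(3) by simp
  qed
  moreover have "finite (plift g a ` inner)" using fin_G by (simp add: inner_def)
  ultimately have "card (insert w (plift g a ` inner)) = 3"
    using card_inner by (simp add: card_image[OF inj])
  moreover have "card (insert w (plift g a ` inner)) \<le> card (nbs (plift g a c))"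
    by (rule card_mono[OF finite_nbs]) (simp add: wn inner_nbs[OF ab(1)])
  ultimately show False using two[OF plift_T[OF ab(1) cG]] by simp
qed

lemma k_eq_1: "k = 1"
proof (rule ccontr)
  assume "k \<noteq> 1"
  then have k2: "2 \<le> k" using k_pos by simp
  then obtain d where d: "fin_dir d" using ex_fin_dir by blast
  show False by (rule not_all_fin_dir[OF k2 fin_dir_all[OF k2 d]])
qed

end

theorem theorem2p1:
  fixes g :: nat and G :: "(nat \<times> nat) set"
  assumes "1 < g" and "is_generator g G"
  shows "grid_tree (fractal g G) \<longleftrightarrow> grid_tree G \<and> nhb G = 1 \<and> nvb G = 1"
proof -
  interpret generator g G by unfold_locales (fact assms)+
  show ?thesis
  proof
    assume "grid_tree (fractal g G)"
    then interpret tree_fractal g G by unfold_locales (simp add: T_def)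
    show "grid_tree G \<and> nhb G = 1 \<and> nvb G = 1"
      using k_eq_1_imp_tree_G[OF k_eq_1] card_con k_eq_1 by (simp add: nhb_eq nvb_eq)
  next
    assume "grid_tree G \<and> nhb G = 1 \<and> nvb G = 1"
    then show "grid_tree (fractal g G)"
      using contacts_singletons_imp_tree by (simp add: nhb_eq nvb_eq T_def)
  qed
qed

end
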